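(* Let $n\ge0$ be an integer. Write the small-$t$ expansions of the form factors as $$f^{(2p)}_{n,n}=t^{p(n+p)}\sum_{m=0}^\infty c^{<}_m t^m\ (p\ge1),\qquad f^{(2p+1)}_{n,n}=t^{n(p+1/2)+p(p+1)}\sum_{m=0}^\infty c^{>}_m t^m\ (p\ge0),$$ with $c^{<,>}_m=c^{<,>}_m(n,p)$. For $t=k^{-2}<1$, $$c^{<}_0=\frac{1}{(p!)^2\pi^{2p}}\frac{\Gamma(n+p+\frac12)\Gamma(p+\frac12)}{\Gamma(n+\frac12)\Gamma(\frac12)}\left(\prod_{j=0}^{p-1}\frac{\Gamma(n+j+\frac12)\Gamma(j+\frac12)\Gamma(j+2)}{\Gamma(n+p+j+1)}\right)^2,$$ $$c^{<}_1=c^{<}_0\,\frac{p(n+p)}{2(n+2p)^2}\left[4p(n+p)+1\right],$$ while for $t=k^{2}<1$, $$c^{>}_0=\frac{1}{p!\,\pi^{2p+1}}\frac{\Gamma(n+\frac12)\Gamma(\frac12)}{\Gamma(n+p+1)}\left(\prod_{j=0}^{p-1}\frac{\Gamma(n+j+\frac32)\Gamma(j+\frac32)\Gamma(j+2)}{\Gamma(n+p+j+2)}\right)^2,$$ $$c^{>}_1=c^{>}_0\,\frac{n+p+\frac12}{2(n+2p+1)^2}\left[4p(p+1)(n+p+\tfrac12)+n+2p+1\right].$$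
   Context: Here $k>0$ is a parameter (for the Ising model $k=\sinh2K_1\sinh2K_2$); $t=k^{-2}$ in the low temperature case $k>1$ and $t=k^2$ in the high temperature case $k<1$. The form factors are defined by $$f^{(2p)}_{n,n}=\frac{t^{p(n+p)}}{(p!)^2\pi^{2p}}\int_0^1dx_1\cdots\int_0^1dx_{2p}\prod_{i=1}^{2p}x_i^n\prod_{j=1}^p\left[\frac{(1-tx_{2j})(x_{2j}^{-1}-1)}{(1-tx_{2j-1})(x_{2j-1}^{-1}-1)}\right]^{1/2}$$ $$\times\prod_{j=1}^p\prod_{l=1}^p(1-tx_{2l-1}x_{2j})^{-2}\prod_{1\le j<l\le p}(x_{2j-1}-x_{2l-1})^2(x_{2j}-x_{2l})^2 ,$$ and $$f^{(2p+1)}_{n,n}=\frac{t^{n(p+1/2)+p(p+1)}}{p!(p+1)!\pi^{2p+1}}\int_0^1dx_1\cdots\int_0^1dx_{2p+1}\prod_{i=1}^{2p+1}x_i^n$$ $$\times\prod_{j=1}^{p+1}\frac{1}{x_{2j-1}}(1-tx_{2j-1})^{-1/2}(x_{2j-1}^{-1}-1)^{-1/2}\prod_{j=1}^px_{2j}(1-tx_{2j})^{1/2}(x_{2j}^{-1}-1)^{1/2}$$ $$\times\prod_{j=1}^{p+1}\prod_{l=1}^p(1-tx_{2j-1}x_{2l})^{-2}\prod_{1\le j<l\le p+1}(x_{2j-1}-x_{2l-1})^2\prod_{1\le j<l\le p}(x_{2j}-x_{2l})^2 .$$ Empty products equal $1$. *)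

theory Defs
  imports "HOL-Analysis.Analysis"
begin

text \<open>
  The form factors are functions of the real variable \<open>t\<close>, which is meant to range over
  \<open>0 < t < 1\<close>. The variables \<open>x\<^sub>1, \<dots>, x\<^sub>N\<close> are the values of a function
  \<open>x :: nat \<Rightarrow> real\<close> at the indices \<open>1, \<dots>, N\<close>, and the \<open>N\<close>-fold integral over \<open>[0,1]\<close> is
  the Lebesgue integral over the unit cube. For \<open>0 < t < 1\<close> the integrands are nonnegative on
  the cube, so this agrees with the iterated integral. The conventions \<open>inverse 0 = 0\<close>,
  \<open>y / 0 = 0\<close> and \<open>0 powr a = 0\<close> affect the integrands only where some \<open>x\<^sub>i\<close> is \<open>0\<close> or \<open>1\<close>.
\<close>

definition cube_integral :: "nat \<Rightarrow> ((nat \<Rightarrow> real) \<Rightarrow> real) \<Rightarrow> real" where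
  "cube_integral N f =
    set_lebesgue_integral (Pi\<^sub>M {1..N} (\<lambda>_. lborel)) (Pi\<^sub>E {1..N} (\<lambda>_. {0..1})) f"

text \<open>\<open>form_factor_even n p\<close> is \<open>f\<close> with superscript \<open>(2p)\<close>, and \<open>form_factor_odd n p\<close> is
  \<open>f\<close> with superscript \<open>(2p+1)\<close>, both with subscript \<open>n,n\<close>.\<close>

definition form_factor_even :: "nat \<Rightarrow> nat \<Rightarrow> real \<Rightarrow> real" where
  "form_factor_even n p t =
    t ^ (p * (n + p)) / ((fact p)\<^sup>2 * pi ^ (2 * p)) *
    cube_integral (2 * p) (\<lambda>x.
      (\<Prod>i\<in>{1..2 * p}. x i ^ n) *
      (\<Prod>j\<in>{1..p}.
        (((1 - t * x (2 * j)) * (inverse (x (2 * j)) - 1)) /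
         ((1 - t * x (2 * j - 1)) * (inverse (x (2 * j - 1)) - 1))) powr (1 / 2)) *
      (\<Prod>j\<in>{1..p}. \<Prod>l\<in>{1..p}. (1 - t * x (2 * l - 1) * x (2 * j)) powi (-2)) *
      (\<Prod>(j, l)\<in>{(j, l). 1 \<le> j \<and> j < l \<and> l \<le> p}.
        (x (2 * j - 1) - x (2 * l - 1))\<^sup>2 * (x (2 * j) - x (2 * l))\<^sup>2))"

definition form_factor_odd :: "nat \<Rightarrow> nat \<Rightarrow> real \<Rightarrow> real" where
  "form_factor_odd n p t =
    t powr (real n * (real p + 1 / 2) + real p * (real p + 1)) /
      (fact p * fact (p + 1) * pi ^ (2 * p + 1)) *
    cube_integral (2 * p + 1) (\<lambda>x.
      (\<Prod>i\<in>{1..2 * p + 1}. x i ^ n) *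
      (\<Prod>j\<in>{1..p + 1}.
        1 / x (2 * j - 1) * (1 - t * x (2 * j - 1)) powr (- 1 / 2) *
        (inverse (x (2 * j - 1)) - 1) powr (- 1 / 2)) *
      (\<Prod>j\<in>{1..p}.
        x (2 * j) * (1 - t * x (2 * j)) powr (1 / 2) * (inverse (x (2 * j)) - 1) powr (1 / 2)) *
      (\<Prod>j\<in>{1..p + 1}. \<Prod>l\<in>{1..p}. (1 - t * x (2 * j - 1) * x (2 * l)) powi (-2)) *
      (\<Prod>(j, l)\<in>{(j, l). 1 \<le> j \<and> j < l \<and> l \<le> p + 1}. (x (2 * j - 1) - x (2 * l - 1))\<^sup>2) *
      (\<Prod>(j, l)\<in>{(j, l). 1 \<le> j \<and> j < l \<and> l \<le> p}. (x (2 * j) - x (2 * l))\<^sup>2))"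

text \<open>The sequence \<open>c\<close> of coefficients does not depend on \<open>k\<close>. As \<open>k\<close> varies, \<open>t\<close> takes every
  value in \<open>(0,1)\<close>, so \<open>c\<close> is determined by the expansion.\<close>

definition low_temp_expansion :: "nat \<Rightarrow> nat \<Rightarrow> (nat \<Rightarrow> real) \<Rightarrow> bool" where
  "low_temp_expansion n p c \<longleftrightarrow>
    (\<forall>k t :: real. k > 1 \<and> t = k powi (-2) \<longrightarrow>
      summable (\<lambda>m. c m * t ^ m) \<and>
      form_factor_even n p t = t ^ (p * (n + p)) * (\<Sum>m. c m * t ^ m))"

definition high_temp_expansion :: "nat \<Rightarrow> nat \<Rightarrow> (nat \<Rightarrow> real) \<Rightarrow> bool" where
  "high_temp_expansion n p c \<longleftrightarrow>
    (\<forall>k t :: real. 0 < k \<and> k < 1 \<and> t = k\<^sup>2 \<longrightarrow>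
      summable (\<lambda>m. c m * t ^ m) \<and>
      form_factor_odd n p t =
        t powr (real n * (real p + 1 / 2) + real p * (real p + 1)) * (\<Sum>m. c m * t ^ m))"

end

theory Submission
  imports Defs "Jordan_Normal_Form.Determinant"
begin

text \<open>
  In the integrand of a form factor, the factors that do not involve \<open>t\<close> split into a function of the
  variables \<open>u\<close> of odd index and a function of the variables \<open>v\<close> of even index. Each of them is the
  integrand of a Selberg integral with the square of the Vandermonde product: Beta weights with
  parameters \<open>(n + 3/2, 1/2)\<close> and \<open>(n + 1/2, 3/2)\<close> for the \<open>2p\<close>-fold integral, and
  \<open>(n + 1/2, 1/2)\<close> and \<open>(n + 3/2, 3/2)\<close> for the \<open>2p + 1\<close>-fold one. So \<open>c 0\<close> is, up to
  the prefactor, a product of two Selberg integrals.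

  The factors that involve \<open>t\<close> are powers of \<open>1 - t * z\<close> with \<open>0 \<le> z \<le> 1\<close>. Their binomial series
  have coefficients that are bounded independently of the point of the cube, so their product can be
  integrated term by term (\<open>integral_dominated_expansion\<close>), and the expansion exists for all
  \<open>0 < t < 1\<close>. The linear coefficient of the product is
  \<open>\<Sum>u / 2 - \<Sum>v / 2 + 2 * \<Sum>u * \<Sum>v\<close>, so \<open>c 1 / c 0\<close> is \<open>X / 2 - Y / 2 + 2 * X * Y\<close>, where
  \<open>X\<close> and \<open>Y\<close> are the means of \<open>\<Sum>u\<close> and \<open>\<Sum>v\<close> under the two Selberg densities
  (\<open>form_factor_series\<close>).

  The Selberg integral and the mean of the sum of the variables are found with orthogonal
  polynomials. The Vandermonde product is the determinant of the values of any monic polynomials of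
  degrees \<open>0, \<dots>, N - 1\<close>. For the monic Jacobi polynomials, orthogonality reduces the integral
  of its square to \<open>N!\<close> times the product of the squared norms, and the mean of the sum to the trace
  of the Jacobi matrix, which telescopes to a single subleading coefficient
  (\<open>orthogonal_ensemble\<close>). The norms come from a Chu--Vandermonde sum
  (\<open>beta_functional_jacobi\<close>). The coefficients of the expansions are unique
  (\<open>powser_coeffs_unique\<close>).
\<close>

section \<open>Power series with dominated coefficients\<close>

text \<open>
  The functions \<open>A m\<close> are the coefficients of the expansion of \<open>F t x\<close> in powers of \<open>t\<close>, for
  \<open>0 < t < 1\<close> and \<open>x \<in> X\<close>. They are bounded on \<open>X\<close> by constants \<open>B m\<close> whose power series
  converges on the same interval, so that the expansion is uniform in \<open>x\<close>.
\<close>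
definition dominated_coeffs ::
  "'a measure \<Rightarrow> 'a set \<Rightarrow> (real \<Rightarrow> 'a \<Rightarrow> real) \<Rightarrow> (nat \<Rightarrow> 'a \<Rightarrow> real) \<Rightarrow> (nat \<Rightarrow> real) \<Rightarrow> bool" where
  "dominated_coeffs M X F A B \<longleftrightarrow>
     (\<forall>m. A m \<in> borel_measurable M) \<and>
     (\<forall>m. \<forall>x\<in>X. \<bar>A m x\<bar> \<le> B m) \<and>
     (\<forall>t\<in>{0<..<1}. summable (\<lambda>m. B m * t ^ m)) \<and>
     (\<forall>t\<in>{0<..<1}. \<forall>x\<in>X. (\<lambda>m. A m x * t ^ m) sums F t x)"

text \<open>
  A normalised expansion \<open>F t x = 1 + s x * t + \<dots>\<close> with coefficients as above. Only the linear
  coefficient \<open>s\<close> is recorded; it is additive under products of functions.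
\<close>
definition dominated_expansion ::
  "'a measure \<Rightarrow> 'a set \<Rightarrow> (real \<Rightarrow> 'a \<Rightarrow> real) \<Rightarrow> ('a \<Rightarrow> real) \<Rightarrow> bool" where
  "dominated_expansion M X F s \<longleftrightarrow>
    (\<exists>A B. dominated_coeffs M X F A B \<and> (\<forall>x\<in>X. A 0 x = 1 \<and> A 1 x = s x))"

lemma dominated_coeffsD:
  assumes "dominated_coeffs M X F A B"
  shows "A m \<in> borel_measurable M"
    and "x \<in> X \<Longrightarrow> \<bar>A m x\<bar> \<le> B m"
    and "t \<in> {0<..<1} \<Longrightarrow> summable (\<lambda>m. B m * t ^ m)"
    and "t \<in> {0<..<1} \<Longrightarrow> x \<in> X \<Longrightarrow> (\<lambda>m. A m x * t ^ m) sums F t x"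
  using assms by (simp_all add: dominated_coeffs_def)

lemma dominated_expansion_one: "dominated_expansion M X (\<lambda>t x. 1) (\<lambda>x. 0)"
  unfolding dominated_expansion_def dominated_coeffs_def
proof (intro exI conjI ballI allI)
  fix t :: real
  have "(\<lambda>m. (if m = 0 then 1 else 0) * t ^ m) = (\<lambda>m. if m = 0 then 1 else 0)" by auto
  then show "(\<lambda>m. (if m = 0 then 1 else 0) * t ^ m) sums 1"
    using sums_single[of 0 "\<lambda>_. 1 :: real"] by simp
  then show "summable (\<lambda>m. (if m = 0 then 1 else 0) * t ^ m)"
    by (simp add: sums_iff)
qed auto

lemma dominated_expansion_mult:
  assumes "dominated_expansion M X F s" "dominated_expansion M X G r"
  shows "dominated_expansion M X (\<lambda>t x. F t x * G t x) (\<lambda>x. s x + r x)"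
proof -
  from assms(1) obtain A B where Ac: "dominated_coeffs M X F A B"
    and A1: "\<And>x. x \<in> X \<Longrightarrow> A 0 x = 1" "\<And>x. x \<in> X \<Longrightarrow> A 1 x = s x"
    unfolding dominated_expansion_def by blast
  note A = dominated_coeffsD[OF Ac] A1
  from assms(2) obtain A' B' where A'c: "dominated_coeffs M X G A' B'"
    and A'1: "\<And>x. x \<in> X \<Longrightarrow> A' 0 x = 1" "\<And>x. x \<in> X \<Longrightarrow> A' 1 x = r x"
    unfolding dominated_expansion_def by blast
  note A' = dominated_coeffsD[OF A'c] A'1
  note [measurable] = A(1) A'(1)
  have cauchy: "(\<lambda>m. (\<Sum>i\<le>m. a i * b (m - i)) * t ^ m) sums
      ((\<Sum>m. a m * t ^ m) * (\<Sum>m. b m * t ^ m))"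
    if "summable (\<lambda>m. \<bar>a m * t ^ m\<bar>)" "summable (\<lambda>m. \<bar>b m * t ^ m\<bar>)" for a b and t :: real
  proof -
    have "(\<Sum>i\<le>m. a i * t ^ i * (b (m - i) * t ^ (m - i))) =
        (\<Sum>i\<le>m. a i * b (m - i)) * t ^ m" for m
      unfolding sum_distrib_right
    proof (rule sum.cong)
      fix i assume "i \<in> {..m}"
      then have "t ^ m = t ^ i * t ^ (m - i)" by (simp add: power_add[symmetric])
      then show "a i * t ^ i * (b (m - i) * t ^ (m - i)) = a i * b (m - i) * t ^ m" by simp
    qed simp
    with Cauchy_product_sums[of "\<lambda>m. a m * t ^ m" "\<lambda>m. b m * t ^ m"] that show ?thesis
      by simp
  qed
  let ?A = "\<lambda>m x. \<Sum>i\<le>m. A i x * A' (m - i) x"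
  let ?B = "\<lambda>m. \<Sum>i\<le>m. \<bar>B i\<bar> * \<bar>B' (m - i)\<bar>"
  \<comment> \<open>Convergence at the larger point \<open>(1 + t) / 2\<close> gives absolute convergence at \<open>t\<close>.\<close>
  have abs_summable: "summable (\<lambda>m. \<bar>b m * t ^ m\<bar>)"
    if "\<And>t. t \<in> {0<..<1} \<Longrightarrow> summable (\<lambda>m. b m * t ^ m)" "t \<in> {0<..<1}"
    for b and t :: real
    using powser_insidea[of b "(1 + t) / 2" t] that(1)[of "(1 + t) / 2"] that(2) by simp
  show ?thesis
    unfolding dominated_expansion_def dominated_coeffs_def
  proof (intro exI[of _ ?A] exI[of _ ?B] conjI ballI allI)
    fix m show "?A m \<in> borel_measurable M" by measurable
  next
    fix m x assume x: "x \<in> X"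
    have "\<bar>?A m x\<bar> \<le> (\<Sum>i\<le>m. \<bar>A i x * A' (m - i) x\<bar>)" by (rule sum_abs)
    also have "\<dots> \<le> ?B m"
      unfolding abs_mult
      by (intro sum_mono mult_mono order_trans[OF A(2)[OF x] abs_ge_self]
          order_trans[OF A'(2)[OF x] abs_ge_self]) auto
    finally show "\<bar>?A m x\<bar> \<le> ?B m" .
  next
    fix t :: real assume t: "t \<in> {0<..<1}"
    have "summable (\<lambda>m. \<bar>\<bar>B m\<bar> * t ^ m\<bar>)" "summable (\<lambda>m. \<bar>\<bar>B' m\<bar> * t ^ m\<bar>)"
      using abs_summable[OF A(3) t] abs_summable[OF A'(3) t] t by (simp_all add: abs_mult)
    from cauchy[OF this] show "summable (\<lambda>m. ?B m * t ^ m)" by (simp add: sums_iff)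
  next
    fix t :: real and x assume t: "t \<in> {0<..<1}" and x: "x \<in> X"
    have "summable (\<lambda>m. \<bar>A m x * t ^ m\<bar>)" "summable (\<lambda>m. \<bar>A' m x * t ^ m\<bar>)"
      using abs_summable[of "\<lambda>m. A m x" t] abs_summable[of "\<lambda>m. A' m x" t] A(4) A'(4) t x
      by (auto simp: sums_iff)
    from cauchy[OF this] show "(\<lambda>m. ?A m x * t ^ m) sums (F t x * G t x)"
      using A(4)[OF t x] A'(4)[OF t x] by (simp add: sums_iff)
  next
    fix x assume x: "x \<in> X"
    show "?A 0 x = 1" using A(5) A'(5) x by simp
    show "?A 1 x = s x + r x" using A(5,6) A'(5,6) x by (simp add: atMost_Suc)
  qed
qed

lemma dominated_expansion_prod:
  assumes "finite I" "\<And>i. i \<in> I \<Longrightarrow> dominated_expansion M X (F i) (s i)"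
  shows "dominated_expansion M X (\<lambda>t x. \<Prod>i\<in>I. F i t x) (\<lambda>x. \<Sum>i\<in>I. s i x)"
  using assms
proof (induction I rule: finite_induct)
  case empty
  then show ?case by (simp add: dominated_expansion_one)
next
  case (insert i I)
  then show ?case by (simp add: dominated_expansion_mult)
qed

lemma dominated_expansion_powr:
  fixes r :: real
  assumes "u \<in> borel_measurable M" "\<And>x. x \<in> X \<Longrightarrow> u x \<in> {0..1}"
  shows "dominated_expansion M X (\<lambda>t x. (1 - t * u x) powr r) (\<lambda>x. - r * u x)"
  unfolding dominated_expansion_def dominated_coeffs_def
proof (intro exI conjI ballI allI)
  let ?A = "\<lambda>m x. (r gchoose m) * (- u x) ^ m" and ?B = "\<lambda>m. \<bar>r gchoose m\<bar>"
  show "?A m \<in> borel_measurable M" for m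
    using assms(1) by measurable
  show "\<bar>?A m x\<bar> \<le> ?B m" if "x \<in> X" for m x
    using assms(2)[OF that] by (simp add: abs_mult power_abs power_le_one mult_left_le)
  show "summable (\<lambda>m. ?B m * t ^ m)" if "t \<in> {0<..<1}" for t :: real
    using powser_insidea[of "\<lambda>m. r gchoose m" "(1 + t) / 2" t] that
      gen_binomial_real[of "(1 + t) / 2" r]
    by (simp add: sums_iff abs_mult)
  show "(\<lambda>m. ?A m x * t ^ m) sums (1 - t * u x) powr r" if "t \<in> {0<..<1}" "x \<in> X" for t x
  proof -
    have "t * u x \<le> t * 1" using that assms(2) by (intro mult_left_mono) auto
    also have "t * 1 < 1" using that by simp
    finally have "t * u x < 1" .
    then have "\<bar>- (t * u x)\<bar> < 1" using that assms(2)[of x] by auto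
    from gen_binomial_real[OF this, of r] show ?thesis
      by (simp add: power_mult_distrib[symmetric] mult_ac)
  qed
qed simp_all

text \<open>
  The constants \<open>B m\<close> make \<open>\<bar>G\<bar>\<close> times a convergent series a majorant, which justifies
  integrating term by term.
\<close>
lemma integral_dominated_expansion:
  fixes G :: "'a \<Rightarrow> real"
  assumes F: "dominated_expansion M X F s" and G: "integrable M G"
    and supp: "\<And>x. x \<notin> X \<Longrightarrow> G x = 0"
  obtains C where "\<And>t. t \<in> {0<..<1} \<Longrightarrow> (\<lambda>m. C m * t ^ m) sums (\<integral>x. G x * F t x \<partial>M)"
    and "C 0 = (\<integral>x. G x \<partial>M)" and "C 1 = (\<integral>x. G x * s x \<partial>M)"
proof -
  from F obtain A B where Ac: "dominated_coeffs M X F A B"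
    and A1: "\<And>x. x \<in> X \<Longrightarrow> A 0 x = 1" "\<And>x. x \<in> X \<Longrightarrow> A 1 x = s x"
    unfolding dominated_expansion_def by blast
  note A = dominated_coeffsD[OF Ac] A1
  note [measurable] = A(1) borel_measurable_integrable[OF G]
  have bound: "norm (G x * A m x) \<le> norm (\<bar>B m\<bar> * G x)" for m x
    using mult_right_mono[of "\<bar>A m x\<bar>" "\<bar>B m\<bar>" "\<bar>G x\<bar>"] A(2)[of x m] supp[of x]
    by (cases "x \<in> X") (auto simp: abs_mult mult_ac)
  have int: "integrable M (\<lambda>x. G x * A m x)" for m
    by (rule Bochner_Integration.integrable_bound[of _ "\<lambda>x. \<bar>B m\<bar> * G x"])
      (use G bound in auto)
  show ?thesis
  proof (rule that[of "\<lambda>m. \<integral>x. G x * A m x \<partial>M"])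
    show "(\<integral>x. G x * A 0 x \<partial>M) = (\<integral>x. G x \<partial>M)"
      by (intro Bochner_Integration.integral_cong) (use supp A(5) in fastforce)+
    show "(\<integral>x. G x * A 1 x \<partial>M) = (\<integral>x. G x * s x \<partial>M)"
      by (intro Bochner_Integration.integral_cong) (use supp A(6) in fastforce)+
  next
    fix t :: real assume t: "t \<in> {0<..<1}"
    let ?f = "\<lambda>m x. G x * A m x * t ^ m"
    have sums: "(\<lambda>m. ?f m x) sums (G x * F t x)" for x
      using sums_mult[OF A(4)[OF t, of x], of "G x"] supp[of x]
      by (cases "x \<in> X") (auto simp: mult_ac)
    have sumB: "summable (\<lambda>m. \<bar>B m * t ^ m\<bar>)"
      using powser_insidea[of B "(1 + t) / 2" t] A(3)[of "(1 + t) / 2"] t by simp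
    have le: "norm (?f m x) \<le> \<bar>B m * t ^ m\<bar> * \<bar>G x\<bar>" for m x
      using mult_right_mono[OF bound[of x m], of "t ^ m"] t by (simp add: abs_mult mult_ac)
    have "(\<lambda>m. \<integral>x. ?f m x \<partial>M) sums (\<integral>x. (\<Sum>m. ?f m x) \<partial>M)"
    proof (rule sums_integral)
      show "integrable M (?f m)" for m using int by simp
      show "AE x in M. summable (\<lambda>m. norm (?f m x))"
        by (intro AE_I2 summable_comparison_test'[OF summable_mult2[OF sumB]])
          (use le in simp)
      show "summable (\<lambda>m. \<integral>x. norm (?f m x) \<partial>M)"
      proof (rule summable_comparison_test'[OF summable_mult2[OF sumB, of "\<integral>x. \<bar>G x\<bar> \<partial>M"]])
        fix m :: nat
        have "(\<integral>x. norm (?f m x) \<partial>M) \<le> (\<integral>x. \<bar>B m * t ^ m\<bar> * \<bar>G x\<bar> \<partial>M)"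
          by (rule integral_mono[OF _ _ le])
            (use int[of m] G in \<open>auto intro!: integrable_norm simp del: real_norm_def\<close>)
        then show "norm (\<integral>x. norm (?f m x) \<partial>M) \<le> \<bar>B m * t ^ m\<bar> * (\<integral>x. \<bar>G x\<bar> \<partial>M)"
          by simp
      qed
    qed
    moreover have "(\<Sum>m. ?f m x) = G x * F t x" for x using sums by (simp add: sums_iff)
    ultimately show "(\<lambda>m. (\<integral>x. G x * A m x \<partial>M) * t ^ m) sums (\<integral>x. G x * F t x \<partial>M)"
      by simp
  qed
qed

lemma powser_coeffs_unique:
  fixes c d :: "nat \<Rightarrow> real"
  assumes c: "\<And>t. t \<in> {0<..<1} \<Longrightarrow> (\<lambda>m. c m * t ^ m) sums f t"
    and d: "\<And>t. t \<in> {0<..<1} \<Longrightarrow> (\<lambda>m. d m * t ^ m) sums f t"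
  shows "c = d"
proof (rule ccontr)
  assume "c \<noteq> d"
  then obtain k where k: "c k - d k \<noteq> 0" by auto
  \<comment> \<open>Dividing the difference of the series by \<open>t ^ k\<close> and letting \<open>t\<close> tend to \<open>0\<close> from the
    right isolates the first coefficient in which they differ.\<close>
  define k where "k = (LEAST k. c k - d k \<noteq> 0)"
  have k0: "c k - d k \<noteq> 0" unfolding k_def using k by (rule LeastI)
  have less: "c m - d m = 0" if "m < k" for m using that not_less_Least unfolding k_def by blast
  let ?e = "\<lambda>m. c (m + k) - d (m + k)"
  have zero: "(\<lambda>m. ?e m * t ^ m) sums 0" if t: "t \<in> {0<..<1}" for t
  proof -
    have "(\<lambda>m. (c m - d m) * t ^ m) sums 0"
      using sums_diff[OF c[OF t] d[OF t]] by (simp add: algebra_simps)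
    then have "(\<lambda>m. (c (m + k) - d (m + k)) * t ^ (m + k)) sums (0 - (\<Sum>m<k. (c m - d m) * t ^ m))"
      by (rule sums_split_initial_segment)
    then have "(\<lambda>m. (?e m * t ^ m) * t ^ k) sums (0 * t ^ k)"
      using less by (simp add: power_add mult_ac)
    then show ?thesis using t by (subst (asm) sums_mult2_iff) auto
  qed
  have "((\<lambda>t. \<Sum>m. ?e m * t ^ m) \<longlongrightarrow> ?e 0) (at 0)"
  proof -
    have s: "summable (\<lambda>m. ?e m * (1 / 2) ^ m)" using zero[of "1 / 2"] by (simp add: sums_iff)
    have "isCont (\<lambda>t. \<Sum>m. ?e m * t ^ m) 0" by (rule isCont_powser[OF s]) simp
    then show ?thesis by (simp add: isCont_def)
  qed
  then have "((\<lambda>t. \<Sum>m. ?e m * t ^ m) \<longlongrightarrow> ?e 0) (at_right 0)"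
    by (rule filterlim_mono) (simp_all add: at_le)
  moreover have "((\<lambda>t. \<Sum>m. ?e m * t ^ m) \<longlongrightarrow> 0) (at_right 0)"
  proof (rule tendsto_eventually)
    show "\<forall>\<^sub>F t in at_right 0. (\<Sum>m. ?e m * t ^ m) = 0"
      unfolding eventually_at_right_field
      by (rule exI[of _ 1]) (use zero in \<open>auto simp: sums_iff\<close>)
  qed
  ultimately have "?e 0 = 0" by (rule tendsto_unique[rotated 1]) simp
  with k0 show False by simp
qed

section \<open>Vandermonde products and orthogonal polynomials\<close>

text \<open>
  The matrix of values factors as the Vandermonde matrix times the matrix of coefficients, and the
  latter is unitriangular.
\<close>
lemma det_monic_polys:
  fixes P :: "nat \<Rightarrow> real poly" and y :: "nat \<Rightarrow> real"
  assumes "\<And>j. j < N \<Longrightarrow> degree (P j) = j" "\<And>j. j < N \<Longrightarrow> coeff (P j) j = 1"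
  shows "Determinant.det (Matrix.mat N N (\<lambda>(i, j). poly (P j) (y i))) =
    Determinant.det (Matrix.mat N N (\<lambda>(i, j). y i ^ j))"
proof -
  let ?V = "Matrix.mat N N (\<lambda>(i, j). y i ^ j)"
  let ?C = "Matrix.mat N N (\<lambda>(k, j). coeff (P j) k)"
  have "Matrix.mat N N (\<lambda>(i, j). poly (P j) (y i)) = ?V * ?C"
  proof (rule eq_matI)
    fix i j assume "i < dim_row (?V * ?C)" "j < dim_col (?V * ?C)"
    then have ij: "i < N" "j < N" by simp_all
    have "poly (P j) (y i) = (\<Sum>k\<le>j. coeff (P j) k * y i ^ k)"
      using assms(1)[OF ij(2)] by (simp add: poly_altdef)
    also have "\<dots> = (\<Sum>k<N. coeff (P j) k * y i ^ k)"
      using ij assms(1)[OF ij(2)] by (intro sum.mono_neutral_left) (auto simp: coeff_eq_0)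
    finally show "Matrix.mat N N (\<lambda>(i, j). poly (P j) (y i)) $$ (i, j) = (?V * ?C) $$ (i, j)"
      using ij by (simp add: scalar_prod_def lessThan_atLeast0 mult.commute)
  qed simp_all
  moreover have "Determinant.det ?C = 1"
  proof -
    have "upper_triangular ?C"
      using assms(1) by (auto simp: upper_triangular_def coeff_eq_0)
    then have "Determinant.det ?C = prod_list (diag_mat ?C)"
      by (rule det_upper_triangular[where n = N]) simp
    also have "diag_mat ?C = map (\<lambda>_. 1) [0..<N]"
      using assms(2) by (auto simp: diag_mat_def)
    finally show ?thesis by (simp add: map_replicate_const)
  qed
  ultimately show ?thesis by (simp add: det_mult[of _ N])
qed

text \<open>The product of the differences of \<open>y 0, \<dots>, y (N - 1)\<close>, the one of larger index first.\<close>
definition vandermonde :: "nat \<Rightarrow> (nat \<Rightarrow> real) \<Rightarrow> real" where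
  "vandermonde N y = (\<Prod>i<N. \<Prod>l<i. y i - y l)"

lemma vandermonde_eq_sum_monic:
  fixes P :: "nat \<Rightarrow> real poly"
  assumes "\<And>j. j < N \<Longrightarrow> degree (P j) = j" "\<And>j. j < N \<Longrightarrow> coeff (P j) j = 1"
  shows "vandermonde N y =
    (\<Sum>p | p permutes {..<N}. of_int (sign p) * (\<Prod>i<N. poly (P (p i)) (y i)))"
proof -
  \<comment> \<open>The Newton basis at the points \<open>y l\<close> makes the matrix of values triangular.\<close>
  let ?Q = "\<lambda>j. \<Prod>l<j. [:- y l, 1:]"
  have degQ: "degree (?Q j) = j" for j
    by (subst degree_prod_eq_sum_degree) auto
  have "lead_coeff (?Q j) = 1" for j
    by (simp add: lead_coeff_prod)
  then have monicQ: "coeff (?Q j) j = 1" for j using degQ[of j] by metis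
  let ?T = "Matrix.mat N N (\<lambda>(i, j). poly (?Q j) (y i))"
  have "Determinant.det ?T = prod_list (diag_mat ?T)"
    by (rule det_lower_triangular[of N]) (auto simp: poly_prod)
  also have "diag_mat ?T = map (\<lambda>i. \<Prod>l<i. y i - y l) [0..<N]"
    by (auto simp: diag_mat_def poly_prod)
  also have "prod_list \<dots> = vandermonde N y"
    by (simp add: vandermonde_def prod.distinct_set_conv_list[symmetric] lessThan_atLeast0)
  finally have "vandermonde N y = Determinant.det ?T" by simp
  also have "\<dots> = Determinant.det (Matrix.mat N N (\<lambda>(i, j). y i ^ j))"
    using degQ monicQ by (intro det_monic_polys) auto
  also have "\<dots> = Determinant.det (Matrix.mat N N (\<lambda>(i, j). poly (P j) (y i)))"
    using assms by (intro det_monic_polys[symmetric]) auto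
  also have "\<dots> = (\<Sum>p | p permutes {..<N}. of_int (sign p) * (\<Prod>i<N. poly (P (p i)) (y i)))"
    by (subst det_def'[of _ N])
      (auto simp: lessThan_atLeast0 intro!: sum.cong prod.cong simp: permutes_in_image[of _ "{0..<N}"])
  finally show ?thesis .
qed

text \<open>
  In the following lemmas the injection \<open>e\<close> says at which indices the variables sit, so that they
  apply to any set of coordinates.
\<close>
lemma has_bochner_integral_prod_polys:
  fixes w :: "real \<Rightarrow> real" and e :: "nat \<Rightarrow> 'i" and r :: "nat \<Rightarrow> real poly"
  assumes w: "\<And>q. integrable lborel (\<lambda>x. w x * poly q x)" and e: "inj_on e {..<N}"
  shows "has_bochner_integral (Pi\<^sub>M (e ` {..<N}) (\<lambda>_. lborel))
     (\<lambda>x. (\<Prod>i<N. w (x (e i))) * (\<Prod>i<N. poly (r i) (x (e i))))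
     (\<Prod>i<N. \<integral>x. w x * poly (r i) x \<partial>lborel)"
proof -
  interpret product_sigma_finite "\<lambda>_ :: 'i. lborel :: real measure" ..
  let ?f = "\<lambda>j x. w x * poly (r (inv_into {..<N} e j)) x"
  have "has_bochner_integral (Pi\<^sub>M (e ` {..<N}) (\<lambda>_. lborel))
     (\<lambda>x. \<Prod>j\<in>e ` {..<N}. ?f j (x j)) (\<Prod>j\<in>e ` {..<N}. \<integral>x. ?f j x \<partial>lborel)"
    unfolding has_bochner_integral_iff
    using w by (auto intro!: product_integrable_prod product_integral_prod)
  then show ?thesis
    using e by (simp add: prod.reindex prod.distrib)
qed

text \<open>
  A form of Andreief's identity: expanding both determinants turns the integral into a sum of
  products of integrals over single variables.
\<close>
lemma has_bochner_integral_vandermonde_sq: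
  fixes w :: "real \<Rightarrow> real" and e :: "nat \<Rightarrow> 'i" and P s :: "nat \<Rightarrow> real poly"
  assumes w: "\<And>q. integrable lborel (\<lambda>x. w x * poly q x)" and e: "inj_on e {..<N}"
    and P: "\<And>j. j < N \<Longrightarrow> degree (P j) = j" "\<And>j. j < N \<Longrightarrow> coeff (P j) j = 1"
  shows "has_bochner_integral (Pi\<^sub>M (e ` {..<N}) (\<lambda>_. lborel))
     (\<lambda>x. (\<Prod>i<N. w (x (e i))) * ((\<Prod>i<N. poly (s i) (x (e i))) *
       (vandermonde N (\<lambda>i. x (e i)))\<^sup>2))
     (\<Sum>p | p permutes {..<N}. \<Sum>q | q permutes {..<N}. of_int (sign p) * of_int (sign q) *
       (\<Prod>i<N. \<integral>x. w x * poly (s i * P (p i) * P (q i)) x \<partial>lborel))"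
proof -
  have expand: "(\<Prod>i<N. w (x (e i))) * ((\<Prod>i<N. poly (s i) (x (e i))) * (vandermonde N (\<lambda>i. x (e i)))\<^sup>2) =
    (\<Sum>p | p permutes {..<N}. \<Sum>q | q permutes {..<N}. of_int (sign p) * of_int (sign q) *
       ((\<Prod>i<N. w (x (e i))) * (\<Prod>i<N. poly (s i * P (p i) * P (q i)) (x (e i)))))" for x
    unfolding power2_eq_square vandermonde_eq_sum_monic[of N P, OF P, simplified] sum_product
    unfolding sum_distrib_left
    by (intro sum.cong refl) (simp add: prod.distrib mult_ac)
  show ?thesis
    unfolding expand
    by (intro has_bochner_integral_sum has_bochner_integral_mult_right
        has_bochner_integral_prod_polys w e)
qed

text \<open>
  By orthogonality only the diagonal terms of that double sum survive. This stays true when one of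
  the factors carries an extra polynomial \<open>r\<close>; for \<open>k \<ge> N\<close> there is no extra polynomial.
\<close>
lemma sum_orthogonal_permutations:
  fixes L :: "real poly \<Rightarrow> real" and P :: "nat \<Rightarrow> real poly" and r :: "real poly" and k N :: nat
  assumes orth: "\<And>i j. i < N \<Longrightarrow> j < N \<Longrightarrow> i \<noteq> j \<Longrightarrow> L (P i * P j) = 0"
  defines "s \<equiv> \<lambda>i. if i = k then r else 1"
  shows "(\<Sum>p | p permutes {..<N}. \<Sum>q | q permutes {..<N}. of_int (sign p) * of_int (sign q) *
       (\<Prod>i<N. L (s i * P (p i) * P (q i)))) =
     (\<Sum>p | p permutes {..<N}. \<Prod>i<N. L (s i * P (p i) * P (p i)))"
proof (rule sum.cong[OF refl])
  fix p assume "p \<in> {p. p permutes {..<N}}"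
  then have p: "p permutes {..<N}" by simp
  have zero: "(\<Prod>i<N. L (s i * P (p i) * P (q i))) = 0" if q: "q permutes {..<N}" and "q \<noteq> p" for q
  proof -
    \<comment> \<open>Two permutations that differ, differ at two places at least.\<close>
    have "\<exists>i. i \<noteq> k \<and> p i \<noteq> q i"
    proof (rule ccontr)
      assume "\<nexists>i. i \<noteq> k \<and> p i \<noteq> q i"
      then have agree: "p i = q i" if "i \<noteq> k" for i using that by blast
      obtain i where i: "p i = q k" using permutes_surj[OF p] by (metis surjD)
      have "i = k" using i agree[of i] permutes_inj[OF q] by (metis injD)
      with i agree have "p = q" by (intro ext) metis
      with \<open>q \<noteq> p\<close> show False by simp
    qed
    then obtain i where i: "i \<noteq> k" "p i \<noteq> q i" by blast
    then have "i < N" using p q unfolding permutes_def by (metis lessThan_iff)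
    then have "L (s i * P (p i) * P (q i)) = 0"
      using i permutes_in_image[OF p, of i] permutes_in_image[OF q, of i] orth
      by (simp add: s_def)
    with \<open>i < N\<close> show ?thesis by (intro prod_zero) auto
  qed
  have "(\<Sum>q | q permutes {..<N}. of_int (sign p) * of_int (sign q) *
       (\<Prod>i<N. L (s i * P (p i) * P (q i)))) =
     (\<Sum>q\<in>{p}. of_int (sign p) * of_int (sign q) * (\<Prod>i<N. L (s i * P (p i) * P (q i))))"
    using p zero by (intro sum.mono_neutral_right) (auto simp: finite_permutations)
  also have "\<dots> = (\<Prod>i<N. L (s i * P (p i) * P (p i)))"
    by (simp flip: of_int_mult)
  finally show "(\<Sum>q | q permutes {..<N}. of_int (sign p) * of_int (sign q) *
       (\<Prod>i<N. L (s i * P (p i) * P (q i)))) = (\<Prod>i<N. L (s i * P (p i) * P (p i)))" .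
qed

text \<open>
  For the density \<open>\<Prod> w (x i) * V\<^sup>2\<close> with the Vandermonde product \<open>V\<close>, the total mass is
  \<open>N!\<close> times the product of the squared norms \<open>h j\<close> of the monic orthogonal polynomials, and the
  mean of \<open>\<Sum> x i\<close> is the sum of the diagonal entries \<open>b j\<close> of the Jacobi matrix.
\<close>
lemma orthogonal_ensemble:
  fixes w :: "real \<Rightarrow> real" and e :: "nat \<Rightarrow> 'i" and P :: "nat \<Rightarrow> real poly"
  defines "L \<equiv> \<lambda>q. \<integral>x. w x * poly q x \<partial>lborel"
  assumes w: "\<And>q. integrable lborel (\<lambda>x. w x * poly q x)" and e: "inj_on e {..<N}"
    and P: "\<And>j. j < N \<Longrightarrow> degree (P j) = j" "\<And>j. j < N \<Longrightarrow> coeff (P j) j = 1"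
    and orth: "\<And>i j. i < N \<Longrightarrow> j < N \<Longrightarrow> i \<noteq> j \<Longrightarrow> L (P i * P j) = 0"
    and norm: "\<And>j. j < N \<Longrightarrow> L (P j * P j) = h j"
    and mean: "\<And>j. j < N \<Longrightarrow> L ([:0, 1:] * P j * P j) = b j * h j"
  shows "has_bochner_integral (Pi\<^sub>M (e ` {..<N}) (\<lambda>_. lborel))
     (\<lambda>x. (\<Prod>i<N. w (x (e i))) * (vandermonde N (\<lambda>i. x (e i)))\<^sup>2)
     (fact N * (\<Prod>j<N. h j))" (is ?A)
   and "has_bochner_integral (Pi\<^sub>M (e ` {..<N}) (\<lambda>_. lborel))
     (\<lambda>x. (\<Prod>i<N. w (x (e i))) * ((\<Sum>i<N. x (e i)) * (vandermonde N (\<lambda>i. x (e i)))\<^sup>2))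
     (fact N * (\<Prod>j<N. h j) * (\<Sum>j<N. b j))" (is ?B)
proof -
  let ?s = "\<lambda>k r i. if i = k then r else (1 :: real poly)"
  have I: "has_bochner_integral (Pi\<^sub>M (e ` {..<N}) (\<lambda>_. lborel))
     (\<lambda>x. (\<Prod>i<N. w (x (e i))) * ((\<Prod>i<N. poly (?s k r i) (x (e i))) *
       (vandermonde N (\<lambda>i. x (e i)))\<^sup>2))
     (\<Sum>p | p permutes {..<N}. \<Prod>i<N. L (?s k r i * P (p i) * P (p i)))" for k r
  proof -
    have "has_bochner_integral (Pi\<^sub>M (e ` {..<N}) (\<lambda>_. lborel))
     (\<lambda>x. (\<Prod>i<N. w (x (e i))) * ((\<Prod>i<N. poly (?s k r i) (x (e i))) *
       (vandermonde N (\<lambda>i. x (e i)))\<^sup>2))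
     (\<Sum>p | p permutes {..<N}. \<Sum>q | q permutes {..<N}. of_int (sign p) * of_int (sign q) *
       (\<Prod>i<N. L (?s k r i * P (p i) * P (q i))))"
      unfolding L_def by (intro has_bochner_integral_vandermonde_sq w e P)
    also have "(\<Sum>p | p permutes {..<N}. \<Sum>q | q permutes {..<N}. of_int (sign p) * of_int (sign q) *
       (\<Prod>i<N. L (?s k r i * P (p i) * P (q i)))) =
       (\<Sum>p | p permutes {..<N}. \<Prod>i<N. L (?s k r i * P (p i) * P (p i)))"
      by (rule sum_orthogonal_permutations) (rule orth)
    finally show ?thesis .
  qed
  have prod_h: "(\<Prod>i<N. h (p i)) = (\<Prod>i<N. h i)" if "p permutes {..<N}" for p
    using prod.permute[OF that, of h] by (simp add: o_def)
  have card: "card {p. p permutes {..<N}} = fact N"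
    by (simp add: card_permutations)
  have "(\<Prod>i<N. poly (?s N 1 i) (x (e i))) = 1" for x
    by (intro prod.neutral) auto
  moreover have "(\<Sum>p | p permutes {..<N}. \<Prod>i<N. L (?s N 1 i * P (p i) * P (p i))) =
      fact N * (\<Prod>j<N. h j)"
  proof -
    have "(\<Prod>i<N. L (?s N 1 i * P (p i) * P (p i))) = (\<Prod>j<N. h j)" if "p permutes {..<N}" for p
    proof -
      have "(\<Prod>i<N. L (?s N 1 i * P (p i) * P (p i))) = (\<Prod>i<N. h (p i))"
        using permutes_in_image[OF that] by (intro prod.cong) (auto simp: norm)
      then show ?thesis using prod_h[OF that] by simp
    qed
    then show ?thesis by (simp add: card)
  qed
  ultimately show ?A using I[of N 1] by simp
  have factor: "(\<Prod>i<N. poly (?s k [:0, 1:] i) (x (e i))) = x (e k)" if "k < N" for k x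
  proof -
    have "(\<Prod>i<N. poly (?s k [:0, 1:] i) (x (e i))) = (\<Prod>i<N. if i = k then x (e i) else 1)"
      by (intro prod.cong) auto
    then show ?thesis using that by simp
  qed
  have "has_bochner_integral (Pi\<^sub>M (e ` {..<N}) (\<lambda>_. lborel))
     (\<lambda>x. \<Sum>k<N. (\<Prod>i<N. w (x (e i))) * (x (e k) * (vandermonde N (\<lambda>i. x (e i)))\<^sup>2))
     (\<Sum>k<N. \<Sum>p | p permutes {..<N}. \<Prod>i<N. L (?s k [:0, 1:] i * P (p i) * P (p i)))"
  proof (rule has_bochner_integral_sum)
    fix k assume "k \<in> {..<N}"
    then have "k < N" by simp
    from I[of k "[:0, 1:]"] show "has_bochner_integral (Pi\<^sub>M (e ` {..<N}) (\<lambda>_. lborel))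
     (\<lambda>x. (\<Prod>i<N. w (x (e i))) * (x (e k) * (vandermonde N (\<lambda>i. x (e i)))\<^sup>2))
     (\<Sum>p | p permutes {..<N}. \<Prod>i<N. L (?s k [:0, 1:] i * P (p i) * P (p i)))"
      unfolding factor[OF \<open>k < N\<close>] .
  qed
  moreover have "(\<Sum>k<N. \<Sum>p | p permutes {..<N}. \<Prod>i<N. L (?s k [:0, 1:] i * P (p i) * P (p i))) =
      fact N * (\<Prod>j<N. h j) * (\<Sum>j<N. b j)"
  proof -
    have "(\<Sum>k<N. \<Prod>i<N. L (?s k [:0, 1:] i * P (p i) * P (p i))) = (\<Prod>j<N. h j) * (\<Sum>j<N. b j)"
      if p: "p permutes {..<N}" for p
    proof -
      have "(\<Prod>i<N. L (?s k [:0, 1:] i * P (p i) * P (p i))) = (\<Prod>j<N. h j) * b (p k)" if "k < N" for k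
      proof -
        have "(\<Prod>i<N. L (?s k [:0, 1:] i * P (p i) * P (p i))) =
            (\<Prod>i<N. h (p i) * (if i = k then b (p i) else 1))"
        proof (intro prod.cong refl)
          fix i assume "i \<in> {..<N}"
          then have "p i < N" using permutes_in_image[OF p] by simp
          from norm[OF this] mean[OF this]
          show "L (?s k [:0, 1:] i * P (p i) * P (p i)) = h (p i) * (if i = k then b (p i) else 1)"
            by (cases "i = k") (simp_all only: if_True if_False refl mult_1_left mult_1_right mult.commute)
        qed
        also have "\<dots> = (\<Prod>j<N. h j) * b (p k)"
          using that by (simp add: prod.distrib prod_h[OF p])
        finally show ?thesis .
      qed
      then have "(\<Sum>k<N. \<Prod>i<N. L (?s k [:0, 1:] i * P (p i) * P (p i))) = (\<Prod>j<N. h j) * (\<Sum>k<N. b (p k))"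
        by (simp add: sum_distrib_left)
      also have "(\<Sum>k<N. b (p k)) = (\<Sum>j<N. b j)"
        using sum.permute[OF p, of b] by (simp add: o_def)
      finally show ?thesis .
    qed
    then have "(\<Sum>p | p permutes {..<N}. \<Sum>k<N. \<Prod>i<N. L (?s k [:0, 1:] i * P (p i) * P (p i))) =
        fact N * ((\<Prod>j<N. h j) * (\<Sum>j<N. b j))"
      by (simp add: card)
    then show ?thesis by (subst sum.swap) (simp add: mult.assoc)
  qed
  ultimately show ?B
    by (simp add: sum_distrib_left sum_distrib_right)
qed

section \<open>Jacobi polynomials and the Selberg integral\<close>

text \<open>
  The density of the Beta integral, with support in the open interval: products of such densities
  then vanish wherever some variable is \<open>0\<close> or \<open>1\<close>, the possible singularities of the integrands.
\<close>
definition beta_weight :: "real \<Rightarrow> real \<Rightarrow> real \<Rightarrow> real" where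
  "beta_weight a b x = indicator {0<..<1} x * (x powr (a - 1) * (1 - x) powr (b - 1))"

lemma beta_weight_mult_powers:
  "beta_weight a b x * (x ^ k * (1 - x) ^ m) = beta_weight (a + real k) (b + real m) x"
proof (cases "x \<in> {0<..<1}")
  case True
  then have "x powr (a - 1) * x ^ k = x powr (a + real k - 1)"
    "(1 - x) powr (b - 1) * (1 - x) ^ m = (1 - x) powr (b + real m - 1)"
    by (simp_all add: powr_realpow[symmetric] powr_add[symmetric] algebra_simps)
  note eqs = this
  have "beta_weight a b x * (x ^ k * (1 - x) ^ m) = indicator {0<..<1} x *
      ((x powr (a - 1) * x ^ k) * ((1 - x) powr (b - 1) * (1 - x) ^ m))"
    by (simp add: beta_weight_def mult_ac)
  then show ?thesis unfolding eqs by (simp add: beta_weight_def)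
qed (simp add: beta_weight_def)

lemma has_bochner_integral_beta_weight:
  assumes "a > 0" "b > 0"
  shows "has_bochner_integral lborel (beta_weight a b) (Beta a b)"
proof -
  let ?f = "\<lambda>t :: real. t powr (a - 1) * (1 - t) powr (b - 1)"
  have int: "set_integrable lborel {0..1} ?f" using assms by (rule integrable_Beta)
  have eq: "(\<lambda>t. indicator {0..1} t *\<^sub>R ?f t) = beta_weight a b"
    by (auto simp: beta_weight_def indicator_def fun_eq_iff)
  have "set_lebesgue_integral lborel {0..1} ?f = Beta a b"
    using set_borel_integral_eq_integral(2)[OF int] has_integral_Beta_real[OF assms]
    by (simp add: integral_unique)
  with int show ?thesis
    unfolding set_integrable_def set_lebesgue_integral_def eq by (simp add: has_bochner_integral_iff)
qed

text \<open>Integration of polynomials against the Beta density.\<close>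
definition beta_functional :: "real \<Rightarrow> real \<Rightarrow> real poly \<Rightarrow> real" where
  "beta_functional a b q = (\<integral>x. beta_weight a b x * poly q x \<partial>lborel)"

lemma integrable_beta_weight_poly:
  assumes "a > 0" "b > 0"
  shows "integrable lborel (\<lambda>x. beta_weight a b x * poly q x)"
proof -
  have "integrable lborel (\<lambda>x. beta_weight a b x * x ^ k)" for k
    using has_bochner_integral_beta_weight[of "a + real k" b] assms
      beta_weight_mult_powers[of a b _ k 0] by (simp add: has_bochner_integral_iff)
  then have "integrable lborel (\<lambda>x. \<Sum>k\<le>degree q. coeff q k * (beta_weight a b x * x ^ k))"
    by (intro Bochner_Integration.integrable_sum integrable_mult_right)
  then show ?thesis by (simp add: poly_altdef sum_distrib_left mult_ac)
qed

lemma beta_functional_add: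
  assumes "a > 0" "b > 0"
  shows "beta_functional a b (q + r) = beta_functional a b q + beta_functional a b r"
  using integrable_beta_weight_poly[OF assms]
  by (simp add: beta_functional_def distrib_left)

lemma beta_functional_smult: "beta_functional a b (Polynomial.smult c q) = c * beta_functional a b q"
proof -
  have "(\<lambda>x. beta_weight a b x * poly (Polynomial.smult c q) x) = (\<lambda>x. c * (beta_weight a b x * poly q x))"
    by (simp add: mult_ac)
  then show ?thesis by (simp add: beta_functional_def)
qed

lemma beta_functional_sum:
  assumes "a > 0" "b > 0"
  shows "beta_functional a b (\<Sum>i\<in>I. q i) = (\<Sum>i\<in>I. beta_functional a b (q i))"
proof (induction I rule: infinite_finite_induct)
  case (insert i I)
  then show ?case by (simp add: beta_functional_add[OF assms])
qed (simp_all add: beta_functional_def)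

lemma beta_functional_powers:
  assumes "a > 0" "b > 0"
  shows "beta_functional a b ([:0, 1:] ^ k * [:1, -1:] ^ m) = Beta (a + real k) (b + real m)"
  using has_bochner_integral_beta_weight[of "a + real k" "b + real m"] assms
  by (simp add: beta_functional_def beta_weight_mult_powers has_bochner_integral_iff)

lemma alternating_choose_sum_Suc:
  fixes f :: "nat \<Rightarrow> 'a :: comm_ring_1"
  shows "(\<Sum>k\<le>Suc n. (- 1) ^ k * of_nat (Suc n choose k) * f k) =
    (\<Sum>k\<le>n. (- 1) ^ k * of_nat (n choose k) * (f k - f (Suc k)))"
proof -
  have "(\<Sum>k\<le>Suc n. (- 1) ^ k * of_nat (Suc n choose k) * f k) =
      (\<Sum>k\<le>Suc n. (- 1) ^ k * of_nat (n choose k) * f k) -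
      (\<Sum>k\<le>n. (- 1) ^ k * of_nat (n choose k) * f (Suc k))"
    unfolding sum.atMost_Suc_shift
    by (simp add: algebra_simps sum.distrib sum_negf sum_subtractf)
  also have "(\<Sum>k\<le>Suc n. (- 1) ^ k * of_nat (n choose k) * f k) =
      (\<Sum>k\<le>n. (- 1) ^ k * of_nat (n choose k) * f k)"
    by (simp add: binomial_eq_0)
  finally show ?thesis by (simp add: sum_subtractf algebra_simps)
qed

text \<open>The Chu--Vandermonde sum, in terms of the Gamma function.\<close>
lemma alternating_Gamma_quotient_sum:
  fixes c d :: real
  assumes "c > 0" "d > 0"
  shows "(\<Sum>k\<le>n. (- 1) ^ k * of_nat (n choose k) * (Gamma (c + real k) / Gamma (d + real k))) =
    pochhammer (d - c) n * Gamma c / Gamma (d + real n)"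
  using assms
proof (induction n arbitrary: c d)
  case 0
  then show ?case by simp
next
  case (Suc n)
  have G: "Gamma (d + real n + 1) = (d + real n) * Gamma (d + real n)" "Gamma (c + 1) = c * Gamma c"
    using Suc.prems by (auto intro!: Gamma_plus1 elim!: nonpos_Ints_cases)
  have nz: "d + real n \<noteq> 0" "Gamma (d + real n) \<noteq> 0"
    using Suc.prems by (auto simp: Gamma_eq_zero_iff elim!: nonpos_Ints_cases)
  have "(\<Sum>k\<le>Suc n. (- 1) ^ k * of_nat (Suc n choose k) * (Gamma (c + real k) / Gamma (d + real k))) =
     (\<Sum>k\<le>n. (- 1) ^ k * of_nat (n choose k) * (Gamma (c + real k) / Gamma (d + real k))) -
     (\<Sum>k\<le>n. (- 1) ^ k * of_nat (n choose k) * (Gamma (c + 1 + real k) / Gamma (d + 1 + real k)))"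
    unfolding alternating_choose_sum_Suc by (simp add: sum_subtractf algebra_simps)
  also have "\<dots> = pochhammer (d - c) n * (Gamma c / Gamma (d + real n) - Gamma (c + 1) / Gamma (d + real n + 1))"
    using Suc.IH[of c d] Suc.IH[of "c + 1" "d + 1"] Suc.prems by (simp add: algebra_simps)
  also have "Gamma c / Gamma (d + real n) - Gamma (c + 1) / Gamma (d + real n + 1) =
      (d - c + real n) * Gamma c / Gamma (d + real n + 1)"
  proof -
    have "Gamma c / Gamma (d + real n) =
        ((d + real n) * Gamma c) / ((d + real n) * Gamma (d + real n))"
      using nz by simp
    then show ?thesis
      unfolding G by (simp only: diff_divide_distrib[symmetric]) (simp only: algebra_simps)
  qed
  finally show ?case by (simp add: pochhammer_Suc add_ac)
qed

text \<open>
  The coefficient of \<open>x ^ k\<close> in the \<open>n\<close>-th monic Jacobi polynomial for the weight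
  \<open>x powr (a - 1) * (1 - x) powr (b - 1)\<close> on \<open>(0, 1)\<close>. Pochhammer symbols instead of quotients of Gamma values keep the formulas meaningful
  for \<open>n = 0\<close> and \<open>a + b = 1\<close>, where \<open>Gamma (a + b + n - 1)\<close> has a pole. This case occurs for
  \<open>a = b = 1 / 2\<close>.
\<close>
definition jacobi_coeff :: "real \<Rightarrow> real \<Rightarrow> nat \<Rightarrow> nat \<Rightarrow> real" where
  "jacobi_coeff a b n k = (- 1) ^ (n - k) * of_nat (n choose k) *
     (pochhammer (a + real k) (n - k) / pochhammer (a + b + real n - 1 + real k) (n - k))"

definition jacobi_poly :: "real \<Rightarrow> real \<Rightarrow> nat \<Rightarrow> real poly" where
  "jacobi_poly a b n = (\<Sum>k\<le>n. monom (jacobi_coeff a b n k) k)"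

lemma coeff_jacobi_poly: "coeff (jacobi_poly a b n) k = (if k \<le> n then jacobi_coeff a b n k else 0)"
  by (simp add: jacobi_poly_def coeff_sum)

lemma monic_jacobi_poly: "degree (jacobi_poly a b n) = n" "coeff (jacobi_poly a b n) n = 1"
proof -
  show 1: "coeff (jacobi_poly a b n) n = 1" by (simp add: coeff_jacobi_poly jacobi_coeff_def)
  show "degree (jacobi_poly a b n) = n"
    by (rule antisym[OF degree_le le_degree]) (auto simp: coeff_jacobi_poly jacobi_coeff_def)
qed

text \<open>The integral of the square of the \<open>n\<close>-th monic Jacobi polynomial.\<close>
definition jacobi_sq_norm :: "real \<Rightarrow> real \<Rightarrow> nat \<Rightarrow> real" where
  "jacobi_sq_norm a b n = fact n * Gamma (a + real n) * Gamma (b + real n) /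
     (pochhammer (a + b + real n - 1) n * Gamma (a + b + 2 * real n))"

text \<open>
  Testing against powers of \<open>1 - x\<close> rather than of \<open>x\<close> makes \<open>Gamma (a + k)\<close> cancel, and what
  is left is a Chu--Vandermonde sum in closed form.
\<close>
lemma beta_functional_jacobi_one_minus_power:
  assumes ab: "a > 0" "b > 0" and "m \<le> n"
  shows "beta_functional a b (jacobi_poly a b n * [:1, -1:] ^ m) =
    (if m = n then (- 1) ^ n * jacobi_sq_norm a b n else 0)"
proof (cases "n = 0")
  case True
  with \<open>m \<le> n\<close> beta_functional_powers[OF ab, of 0 0] show ?thesis
    by (simp add: jacobi_poly_def jacobi_coeff_def jacobi_sq_norm_def Beta_def one_pCons)
next
  case False
  then have c: "a + b + real n - 1 > 0" using ab by linarith
  have pos: "Gamma z \<noteq> 0" if "z > 0" for z :: real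
    using that Gamma_real_pos[of z] by linarith
  have poch: "pochhammer z k = Gamma (z + real k) / Gamma z" if "z > 0" for z :: real and k
    using that by (intro pochhammer_Gamma) (auto elim!: nonpos_Ints_cases)
  let ?K = "(- 1) ^ n * Gamma (a + real n) * Gamma (b + real m) / Gamma (a + b + 2 * real n - 1)"
  have summand: "jacobi_coeff a b n k * Beta (a + real k) (b + real m) =
      ?K * ((- 1) ^ k * of_nat (n choose k) *
        (Gamma (a + b + real n - 1 + real k) / Gamma (a + b + real m + real k)))" if "k \<le> n" for k
  proof -
    have "(- 1 :: real) ^ (n - k) = (- 1) ^ n * (- 1) ^ k"
      using that by (simp add: minus_one_power_iff)
    moreover have "pochhammer (a + real k) (n - k) = Gamma (a + real n) / Gamma (a + real k)"
      using poch[of "a + real k" "n - k"] ab that by (simp add: of_nat_diff)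
    moreover have "pochhammer (a + b + real n - 1 + real k) (n - k) =
        Gamma (a + b + 2 * real n - 1) / Gamma (a + b + real n - 1 + real k)"
      using poch[of "a + b + real n - 1 + real k" "n - k"] c that
      by (simp add: of_nat_diff algebra_simps)
    moreover have "Gamma (a + real k) \<noteq> 0" using ab by (intro pos) simp
    ultimately show ?thesis
      unfolding jacobi_coeff_def Beta_def by (simp add: field_simps)
  qed
  have "beta_functional a b (jacobi_poly a b n * [:1, -1:] ^ m) =
      (\<Sum>k\<le>n. jacobi_coeff a b n k * Beta (a + real k) (b + real m))"
    unfolding jacobi_poly_def sum_distrib_right beta_functional_sum[OF ab]
    by (intro sum.cong refl)
      (simp add: monom_altdef beta_functional_smult beta_functional_powers[OF ab])
  also have "\<dots> = ?K * (\<Sum>k\<le>n. (- 1) ^ k * of_nat (n choose k) *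
        (Gamma (a + b + real n - 1 + real k) / Gamma (a + b + real m + real k)))"
    unfolding sum_distrib_left by (intro sum.cong refl summand) simp
  also have "\<dots> = ?K * (pochhammer (real m + 1 - real n) n * Gamma (a + b + real n - 1) /
      Gamma (a + b + real m + real n))"
  proof -
    have diff: "a + b + real m - (a + b + real n - 1) = real m + 1 - real n" by simp
    have "a + b + real m > 0" using ab by simp
    from alternating_Gamma_quotient_sum[OF c this, of n, unfolded diff] show ?thesis by simp
  qed
  finally have *: "beta_functional a b (jacobi_poly a b n * [:1, -1:] ^ m) = \<dots>" .
  show ?thesis
  proof (cases "m = n")
    case True
    have "pochhammer (a + b + real n - 1) n =
        Gamma (a + b + 2 * real n - 1) / Gamma (a + b + real n - 1)"
      using poch[OF c, of n] by (simp add: algebra_simps)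
    with True * show ?thesis
      by (simp add: jacobi_sq_norm_def pochhammer_fact[symmetric] add_ac)
  next
    case False
    with \<open>m \<le> n\<close> have "m < n" by simp
    then have "real m + 1 - real n = - real (n - Suc m)" by simp
    moreover have "pochhammer (- real (n - Suc m)) n = 0"
      using \<open>m < n\<close> by (subst pochhammer_of_nat_eq_0_iff) simp
    ultimately have "pochhammer (real m + 1 - real n) n = 0" by metis
    then show ?thesis unfolding * using \<open>m < n\<close> by simp
  qed
qed

text \<open>Orthogonality and the squared norm in one statement.\<close>
lemma beta_functional_jacobi:
  assumes ab: "a > 0" "b > 0" and "degree q \<le> n"
  shows "beta_functional a b (jacobi_poly a b n * q) = coeff q n * jacobi_sq_norm a b n"
proof -
  define r where "r = pcompose q [:1, -1:]"
  have degr: "degree r \<le> n" unfolding r_def by (simp add: assms(3) degree_pcompose)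
  have q: "q = (\<Sum>m\<le>n. Polynomial.smult (coeff r m) ([:1, -1:] ^ m))"
  proof (rule poly_ext)
    fix x
    have "poly q x = poly r (1 - x)" by (simp add: r_def poly_pcompose)
    also have "\<dots> = (\<Sum>m\<le>degree r. coeff r m * (1 - x) ^ m)" by (rule poly_altdef)
    also have "\<dots> = (\<Sum>m\<le>n. coeff r m * (1 - x) ^ m)"
      using degr by (intro sum.mono_neutral_left) (auto simp: coeff_eq_0)
    finally show "poly q x = poly (\<Sum>m\<le>n. Polynomial.smult (coeff r m) ([:1, -1:] ^ m)) x"
      by (simp add: poly_sum)
  qed
  have rn: "coeff r n = (- 1) ^ n * coeff q n"
  proof (cases "degree q = n")
    case True
    then show ?thesis
      using lead_coeff_comp[of "[:1, -1:] :: real poly" q] by (simp add: r_def degree_pcompose)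
  next
    case False
    with assms(3) have "degree q < n" by simp
    then show ?thesis by (simp add: r_def coeff_eq_0 degree_pcompose)
  qed
  have "beta_functional a b (jacobi_poly a b n * q) =
      (\<Sum>m\<le>n. coeff r m * beta_functional a b (jacobi_poly a b n * [:1, -1:] ^ m))"
    by (subst q) (simp add: sum_distrib_left beta_functional_sum[OF ab] beta_functional_smult)
  also have "\<dots> = (\<Sum>m\<le>n. if m = n then coeff r n * ((- 1) ^ n * jacobi_sq_norm a b n) else 0)"
    by (intro sum.cong refl) (simp add: beta_functional_jacobi_one_minus_power[OF ab])
  also have "\<dots> = coeff q n * jacobi_sq_norm a b n"
    by (simp add: rn flip: power_mult_distrib)
  finally show ?thesis .
qed

text \<open>
  The diagonal of the Jacobi matrix. The coefficient of \<open>jacobi_poly a b n\<close> below the leading one is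
  \<open>- S n\<close>, so the entries telescope when summed over \<open>n\<close>.
\<close>
lemma jacobi_mean:
  assumes ab: "a > 0" "b > 0"
  defines "S \<equiv> \<lambda>n :: nat. real n * (a + real n - 1) / (a + b + 2 * real n - 2)"
  shows "beta_functional a b ([:0, 1:] * jacobi_poly a b n * jacobi_poly a b n) =
    (S (Suc n) - S n) * jacobi_sq_norm a b n"
proof -
  let ?J = "jacobi_poly a b"
  define r where "r = [:0, 1:] * ?J n - ?J (Suc n)"
  have sub: "(if n = 0 then 0 else coeff (?J n) (n - 1)) = - S n" for n
  proof (cases n)
    case 0
    then show ?thesis by (simp add: S_def)
  next
    case (Suc k)
    have denom: "a + b + real (Suc k) - 1 + real k = a + b + 2 * real (Suc k) - 2" by simp
    have "jacobi_coeff a b (Suc k) k =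
        - (real (Suc k) * (a + real k) / (a + b + 2 * real (Suc k) - 2))"
      unfolding jacobi_coeff_def denom by (simp del: of_nat_Suc)
    then show ?thesis using Suc by (simp add: S_def coeff_jacobi_poly)
  qed
  have coeff_r: "coeff r k = (if k = 0 then 0 else coeff (?J n) (k - 1)) - coeff (?J (Suc n)) k" for k
    by (cases k) (simp_all add: r_def)
  have "degree r \<le> n"
  proof (rule degree_le, intro allI impI)
    fix k assume "n < k"
    then show "coeff r k = 0"
      by (cases "k = Suc n") (auto simp: coeff_r coeff_jacobi_poly jacobi_coeff_def)
  qed
  moreover have "coeff r n = S (Suc n) - S n"
    using sub[of n] sub[of "Suc n"] by (simp add: coeff_r)
  ultimately have "beta_functional a b (?J n * r) = (S (Suc n) - S n) * jacobi_sq_norm a b n"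
    using beta_functional_jacobi[OF ab] by simp
  moreover have "beta_functional a b (?J (Suc n) * ?J n) = 0"
    using beta_functional_jacobi[OF ab, of "?J n" "Suc n"]
    by (simp add: monic_jacobi_poly coeff_eq_0)
  moreover have "[:0, 1:] * ?J n * ?J n = ?J n * r + ?J (Suc n) * ?J n"
    by (simp add: r_def algebra_simps)
  ultimately show ?thesis by (simp add: beta_functional_add[OF ab])
qed

text \<open>The value of Selberg's integral with exponent \<open>2\<close> on the differences of the variables.\<close>
definition selberg :: "nat \<Rightarrow> real \<Rightarrow> real \<Rightarrow> real" where
  "selberg N a b = (\<Prod>j<N. Gamma (a + real j) * Gamma (b + real j) * Gamma (real j + 2) /
     Gamma (a + b + real N - 1 + real j))"

lemma prod_jacobi_sq_norm:
  assumes ab: "a > 0" "b > 0"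
  shows "fact N * (\<Prod>j<N. jacobi_sq_norm a b j) = selberg N a b"
proof -
  have facts: "fact N * (\<Prod>j<N. fact j) = (\<Prod>j<N. Gamma (real j + 2))"
  proof (induction N)
    case (Suc N)
    have "Gamma (real N + 2) = fact (Suc N)"
      using Gamma_fact[of "Suc N", where 'a = real] by (simp add: add_ac)
    with Suc show ?case by (simp add: mult_ac)
  qed simp
  have "(\<Prod>j<N. pochhammer (a + b + real j - 1) j * Gamma (a + b + 2 * real j)) =
      (\<Prod>j<N. Gamma (a + b + real N - 1 + real j))"
  proof (induction N)
    case (Suc N)
    show ?case
    proof (cases "N = 0")
      case False
      then have c: "a + b + real N - 1 > 0" using ab by linarith
      \<comment> \<open>For \<open>N = 0\<close> the factor \<open>?G 0\<close> may be a pole, hence the distinction. Otherwise split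
        \<open>\<Prod>j<N + 2. ?G j\<close> at its first factor and at its last two.\<close>
      let ?G = "\<lambda>j. Gamma (a + b + real N - 1 + real j)"
      define P where "P = (\<Prod>j<Suc N. Gamma (a + b + real (Suc N) - 1 + real j))"
      have nz: "Gamma (a + b + real N - 1) \<noteq> 0" using Gamma_real_pos[OF c] by linarith
      have poch: "pochhammer (a + b + real N - 1) N = ?G N / Gamma (a + b + real N - 1)"
        using c by (intro pochhammer_Gamma) (auto elim!: nonpos_Ints_cases)
      have "(\<Prod>j<Suc (Suc N). ?G j) = Gamma (a + b + real N - 1) * P"
        unfolding P_def by (subst prod.lessThan_Suc_shift) (simp add: algebra_simps)
      moreover have "(\<Prod>j<Suc (Suc N). ?G j) = (\<Prod>j<N. ?G j) * ?G N * Gamma (a + b + 2 * real N)"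
        by (simp add: algebra_simps)
      ultimately have "(\<Prod>j<N. ?G j) * ?G N * Gamma (a + b + 2 * real N) =
          Gamma (a + b + real N - 1) * P" by simp
      then have "(\<Prod>j<N. ?G j) * (pochhammer (a + b + real N - 1) N * Gamma (a + b + 2 * real N)) = P"
        unfolding poch using nz by (simp add: divide_simps mult_ac)
      then show ?thesis unfolding P_def[symmetric] unfolding prod.lessThan_Suc Suc.IH .
    qed simp
  qed simp
  moreover have "(\<Prod>j<N. jacobi_sq_norm a b j) = (\<Prod>j<N. fact j) *
      (\<Prod>j<N. Gamma (a + real j) * Gamma (b + real j)) /
      (\<Prod>j<N. pochhammer (a + b + real j - 1) j * Gamma (a + b + 2 * real j))"
    by (simp add: jacobi_sq_norm_def prod_dividef prod.distrib mult_ac)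
  ultimately show ?thesis
    using facts by (simp add: selberg_def prod_dividef prod.distrib mult_ac)
qed

text \<open>
  Selberg's integral and the mean of \<open>\<Sum> x i\<close> with respect to its integrand; the latter is a case of
  Aomoto's integral.
\<close>
lemma selberg_integral:
  fixes e :: "nat \<Rightarrow> 'i"
  assumes ab: "a > 0" "b > 0" and e: "inj_on e {..<N}"
  shows "has_bochner_integral (Pi\<^sub>M (e ` {..<N}) (\<lambda>_. lborel))
     (\<lambda>x. (\<Prod>i<N. beta_weight a b (x (e i))) * (vandermonde N (\<lambda>i. x (e i)))\<^sup>2)
     (selberg N a b)"
   and "has_bochner_integral (Pi\<^sub>M (e ` {..<N}) (\<lambda>_. lborel))
     (\<lambda>x. (\<Prod>i<N. beta_weight a b (x (e i))) *
       ((\<Sum>i<N. x (e i)) * (vandermonde N (\<lambda>i. x (e i)))\<^sup>2))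
     (selberg N a b * (real N * (a + real N - 1) / (a + b + 2 * real N - 2)))"
proof -
  let ?S = "\<lambda>n :: nat. real n * (a + real n - 1) / (a + b + 2 * real n - 2)"
  let ?P = "jacobi_poly a b"
  have orth: "beta_functional a b (?P i * ?P j) = 0" if "i \<noteq> j" for i j
  proof (cases "i < j")
    case True
    have "beta_functional a b (?P j * ?P i) = 0"
      using True by (subst beta_functional_jacobi[OF ab]) (simp_all add: monic_jacobi_poly coeff_eq_0)
    then show ?thesis by (simp add: mult.commute)
  next
    case False
    with that have "j < i" by simp
    then show ?thesis
      by (subst beta_functional_jacobi[OF ab]) (simp_all add: monic_jacobi_poly coeff_eq_0)
  qed
  have norm: "beta_functional a b (?P j * ?P j) = jacobi_sq_norm a b j" for j
    by (subst beta_functional_jacobi[OF ab]) (simp_all add: monic_jacobi_poly)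
  have tele: "(\<Sum>j<N. ?S (Suc j) - ?S j) = ?S N"
    using sum_lessThan_telescope[of ?S N] by simp
  note ensemble = orthogonal_ensemble[where w = "beta_weight a b" and P = ?P and e = e
      and h = "jacobi_sq_norm a b" and b = "\<lambda>j. ?S (Suc j) - ?S j" and N = N,
      folded beta_functional_def,
      OF integrable_beta_weight_poly[OF ab] e monic_jacobi_poly orth norm jacobi_mean[OF ab],
      unfolded prod_jacobi_sq_norm[OF ab] tele]
  show "has_bochner_integral (Pi\<^sub>M (e ` {..<N}) (\<lambda>_. lborel))
     (\<lambda>x. (\<Prod>i<N. beta_weight a b (x (e i))) * (vandermonde N (\<lambda>i. x (e i)))\<^sup>2)
     (selberg N a b)"
    by (rule ensemble(1))
  show "has_bochner_integral (Pi\<^sub>M (e ` {..<N}) (\<lambda>_. lborel))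
     (\<lambda>x. (\<Prod>i<N. beta_weight a b (x (e i))) *
       ((\<Sum>i<N. x (e i)) * (vandermonde N (\<lambda>i. x (e i)))\<^sup>2))
     (selberg N a b * ?S N)"
    by (rule ensemble(2))
qed

section \<open>Integrals over two groups of variables\<close>

lemma (in pair_sigma_finite) has_bochner_integral_mult:
  fixes f :: "'a \<Rightarrow> real" and g :: "'b \<Rightarrow> real"
  assumes "has_bochner_integral M1 f u" "has_bochner_integral M2 g v"
  shows "has_bochner_integral (M1 \<Otimes>\<^sub>M M2) (\<lambda>(x, y). f x * g y) (u * v)"
proof -
  from assms have f: "integrable M1 f" "integral\<^sup>L M1 f = u"
    and g: "integrable M2 g" "integral\<^sup>L M2 g = v" by (simp_all add: has_bochner_integral_iff)
  note [measurable] = borel_measurable_integrable[OF f(1)] borel_measurable_integrable[OF g(1)]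
  have int: "integrable (M1 \<Otimes>\<^sub>M M2) (\<lambda>(x, y). f x * g y)"
    by (rule Fubini_integrable) (use f g in \<open>auto simp: abs_mult\<close>)
  have "integral\<^sup>L (M1 \<Otimes>\<^sub>M M2) (\<lambda>(x, y). f x * g y) = (\<integral>x. (\<integral>y. f x * g y \<partial>M2) \<partial>M1)"
    using integral_fst'[OF int] by simp
  also have "\<dots> = u * v" using f g by simp
  finally show ?thesis using int by (simp add: has_bochner_integral_iff)
qed

lemma (in product_sigma_finite) has_bochner_integral_PiM_Un:
  fixes f g :: "('i \<Rightarrow> 'a) \<Rightarrow> real"
  assumes f: "has_bochner_integral (Pi\<^sub>M I M) f u" and g: "has_bochner_integral (Pi\<^sub>M J M) g v"
    and I: "finite I" and J: "finite J" and disj: "I \<inter> J = {}"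
    and f_dep: "\<And>x. f (restrict x I) = f x" and g_dep: "\<And>x. g (restrict x J) = g x"
  shows "has_bochner_integral (Pi\<^sub>M (I \<union> J) M) (\<lambda>x. f x * g x) (u * v)"
proof -
  interpret I: finite_product_sigma_finite M I by standard fact
  interpret J: finite_product_sigma_finite M J by standard fact
  interpret P: pair_sigma_finite "Pi\<^sub>M I M" "Pi\<^sub>M J M" ..
  have f_meas: "f \<in> borel_measurable (Pi\<^sub>M I M)" and g_meas: "g \<in> borel_measurable (Pi\<^sub>M J M)"
    using f g by (auto simp: has_bochner_integral_iff)
  have "(\<lambda>x. f (restrict x I)) \<in> borel_measurable (Pi\<^sub>M (I \<union> J) M)"
    by (rule measurable_compose[OF measurable_restrict_subset f_meas]) simp
  moreover have "(\<lambda>x. g (restrict x J)) \<in> borel_measurable (Pi\<^sub>M (I \<union> J) M)"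
    by (rule measurable_compose[OF measurable_restrict_subset g_meas]) simp
  ultimately have meas: "(\<lambda>x. f x * g x) \<in> borel_measurable (Pi\<^sub>M (I \<union> J) M)"
    unfolding f_dep g_dep by (rule borel_measurable_times)
  have "has_bochner_integral (Pi\<^sub>M I M \<Otimes>\<^sub>M Pi\<^sub>M J M) (\<lambda>z. f (merge I J z) * g (merge I J z)) (u * v)"
  proof -
    have "f (merge I J (x, y)) = f x" "g (merge I J (x, y)) = g y" for x y
      using f_dep[of "merge I J (x, y)"] f_dep[of x] g_dep[of "merge I J (x, y)"] g_dep[of y] disj
      by simp_all
    then have "(\<lambda>z. f (merge I J z) * g (merge I J z)) = (\<lambda>(x, y). f x * g y)"
      by (auto simp: fun_eq_iff)
    then show ?thesis using P.has_bochner_integral_mult[OF f g] by simp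
  qed
  then have "has_bochner_integral (distr (Pi\<^sub>M I M \<Otimes>\<^sub>M Pi\<^sub>M J M) (Pi\<^sub>M (I \<union> J) M) (merge I J))
      (\<lambda>x. f x * g x) (u * v)"
    by (intro has_bochner_integral_distr meas) measurable
  then show ?thesis by (simp add: distr_merge[OF disj I J])
qed

lemma vandermonde_cong:
  "(\<And>i. i < N \<Longrightarrow> y i = z i) \<Longrightarrow> vandermonde N y = vandermonde N z"
  by (simp add: vandermonde_def)

text \<open>
  The product of a Selberg integrand in the \<open>q\<close> variables of odd index and one in the \<open>p\<close> variables
  of even index. For suitable parameters it is the integrand of a form factor at \<open>t = 0\<close>, up to
  boundary points of the cube.
\<close>
definition selberg_density ::
  "nat \<Rightarrow> real \<Rightarrow> real \<Rightarrow> nat \<Rightarrow> real \<Rightarrow> real \<Rightarrow> (nat \<Rightarrow> real) \<Rightarrow> real" where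
  "selberg_density q a b p a' b' x =
    (\<Prod>i<q. beta_weight a b (x (2 * i + 1))) * (vandermonde q (\<lambda>i. x (2 * i + 1)))\<^sup>2 *
    ((\<Prod>j<p. beta_weight a' b' (x (2 * j + 2))) * (vandermonde p (\<lambda>j. x (2 * j + 2)))\<^sup>2)"

lemma selberg_density_eq_0:
  assumes "k \<in> (\<lambda>i. 2 * i + 1) ` {..<q} \<union> (\<lambda>j. 2 * j + 2) ` {..<p}" "x k \<notin> {0<..<1}"
  shows "selberg_density q a b p a' b' x = 0"
proof -
  have w: "beta_weight c d (x k) = 0" for c d
    using assms(2) by (simp add: beta_weight_def)
  from assms(1) consider i where "i < q" "k = 2 * i + 1" | j where "j < p" "k = 2 * j + 2"
    by blast
  then show ?thesis
  proof cases
    case (1 i)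
    with w[of a b] have "(\<Prod>i<q. beta_weight a b (x (2 * i + 1))) = 0"
      by (intro prod_zero bexI[of _ i]) auto
    then show ?thesis by (simp only: selberg_density_def mult_zero_left)
  next
    case (2 j)
    with w[of a' b'] have "(\<Prod>j<p. beta_weight a' b' (x (2 * j + 2))) = 0"
      by (intro prod_zero bexI[of _ j]) auto
    then show ?thesis by (simp only: selberg_density_def mult_zero_left mult_zero_right)
  qed
qed

text \<open>The part of the integrand that depends on \<open>t\<close>.\<close>
definition coupling :: "nat \<Rightarrow> nat \<Rightarrow> real \<Rightarrow> (nat \<Rightarrow> real) \<Rightarrow> real" where
  "coupling q p t x =
    (\<Prod>i<q. (1 - t * x (2 * i + 1)) powr (- 1 / 2)) * (\<Prod>j<p. (1 - t * x (2 * j + 2)) powr (1 / 2)) *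
    (\<Prod>i<q. \<Prod>j<p. (1 - t * (x (2 * i + 1) * x (2 * j + 2))) powr (- 2))"

text \<open>
  The coupling is \<open>1 + (\<Sum>u / 2 - \<Sum>v / 2 + 2 * \<Sum>u * \<Sum>v) * t + \<dots>\<close>, where \<open>u\<close> are the variables of
  odd index and \<open>v\<close> those of even index. The two groups are independent under the density at
  \<open>t = 0\<close>, and \<open>X\<close> and \<open>Y\<close> are the means of \<open>\<Sum>u\<close> and \<open>\<Sum>v\<close>. The last claim is recorded for
  the later comparison with the integrands of the form factors.
\<close>
lemma form_factor_series:
  fixes p q :: nat and a b a' b' :: real
  assumes pos: "a > 0" "b > 0" "a' > 0" "b' > 0"
    and index: "(\<lambda>i. 2 * i + 1) ` {..<q} \<union> (\<lambda>j. 2 * j + 2) ` {..<p} = {1..N :: nat}"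
  defines "M \<equiv> Pi\<^sub>M {1..N} (\<lambda>_. lborel :: real measure)"
    and "S \<equiv> selberg q a b * selberg p a' b'"
    and "X \<equiv> real q * (a + real q - 1) / (a + b + 2 * real q - 2)"
    and "Y \<equiv> real p * (a' + real p - 1) / (a' + b' + 2 * real p - 2)"
  obtains C where
    "\<And>t. t \<in> {0<..<1} \<Longrightarrow>
       (\<lambda>m. C m * t ^ m) sums (\<integral>x. selberg_density q a b p a' b' x * coupling q p t x \<partial>M)"
    and "C 0 = S" and "C 1 = S * (X / 2 - Y / 2 + 2 * X * Y)"
    and "\<And>t. (\<lambda>x. selberg_density q a b p a' b' x * coupling q p t x) \<in> borel_measurable M"
proof -
  interpret product_sigma_finite "\<lambda>_ :: nat. lborel :: real measure" ..
  let ?d = "\<lambda>i :: nat. 2 * i + 1" and ?e = "\<lambda>j :: nat. 2 * j + 2"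
  let ?w = "\<lambda>x. \<Prod>i<q. beta_weight a b (x (?d i))" and ?w' = "\<lambda>x. \<Prod>j<p. beta_weight a' b' (x (?e j))"
  let ?V = "\<lambda>x. (vandermonde q (\<lambda>i. x (?d i)))\<^sup>2" and ?V' = "\<lambda>x. (vandermonde p (\<lambda>j. x (?e j)))\<^sup>2"
  let ?sx = "\<lambda>x. \<Sum>i<q. x (?d i)" and ?sy = "\<lambda>x. \<Sum>j<p. x (?e j)"
  let ?G = "selberg_density q a b p a' b'"
  have disj: "?d ` {..<q} \<inter> ?e ` {..<p} = {}" by auto presburger
  have inj: "inj_on ?d {..<q}" "inj_on ?e {..<p}" by (auto simp: inj_on_def)
  note dep = prod.cong_simp sum.cong_simp vandermonde_cong
  note odd0 = selberg_integral(1)[OF pos(1,2) inj(1)] and odd1 = selberg_integral(2)[OF pos(1,2) inj(1), folded X_def]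
  note even0 = selberg_integral(1)[OF pos(3,4) inj(2)] and even1 = selberg_integral(2)[OF pos(3,4) inj(2), folded Y_def]
  note Un = has_bochner_integral_PiM_Un[OF _ _ _ _ disj, unfolded index, folded M_def]
  have I00: "has_bochner_integral M (\<lambda>x. ?w x * ?V x * (?w' x * ?V' x)) (selberg q a b * selberg p a' b')"
    by (rule Un[OF odd0 even0]) (simp_all cong: dep)
  have I10: "has_bochner_integral M (\<lambda>x. ?w x * (?sx x * ?V x) * (?w' x * ?V' x))
      (selberg q a b * X * selberg p a' b')"
    by (rule Un[OF odd1 even0]) (simp_all cong: dep)
  have I01: "has_bochner_integral M (\<lambda>x. ?w x * ?V x * (?w' x * (?sy x * ?V' x)))
      (selberg q a b * (selberg p a' b' * Y))"
    by (rule Un[OF odd0 even1]) (simp_all cong: dep)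
  have I11: "has_bochner_integral M (\<lambda>x. ?w x * (?sx x * ?V x) * (?w' x * (?sy x * ?V' x)))
      (selberg q a b * X * (selberg p a' b' * Y))"
    by (rule Un[OF odd1 even1]) (simp_all cong: dep)
  have G: "has_bochner_integral M ?G S"
    using I00 by (simp add: selberg_density_def[abs_def] S_def)
  define s where "s x = ?sx x / 2 - ?sy x / 2 + 2 * ?sx x * ?sy x" for x :: "nat \<Rightarrow> real"
  have "has_bochner_integral M
     (\<lambda>x. 1 / 2 * (?w x * (?sx x * ?V x) * (?w' x * ?V' x)) - 1 / 2 * (?w x * ?V x * (?w' x * (?sy x * ?V' x)))
        + 2 * (?w x * (?sx x * ?V x) * (?w' x * (?sy x * ?V' x))))
     (1 / 2 * (selberg q a b * X * selberg p a' b') - 1 / 2 * (selberg q a b * (selberg p a' b' * Y))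
        + 2 * (selberg q a b * X * (selberg p a' b' * Y)))"
    by (intro has_bochner_integral_add has_bochner_integral_diff has_bochner_integral_mult_right I10 I01 I11)
  also have "(\<lambda>x. 1 / 2 * (?w x * (?sx x * ?V x) * (?w' x * ?V' x)) - 1 / 2 * (?w x * ?V x * (?w' x * (?sy x * ?V' x)))
        + 2 * (?w x * (?sx x * ?V x) * (?w' x * (?sy x * ?V' x)))) = (\<lambda>x. ?G x * s x)"
    by (simp add: fun_eq_iff selberg_density_def s_def field_simps)
  also have "1 / 2 * (selberg q a b * X * selberg p a' b') - 1 / 2 * (selberg q a b * (selberg p a' b' * Y))
        + 2 * (selberg q a b * X * (selberg p a' b' * Y)) = S * (X / 2 - Y / 2 + 2 * X * Y)"
    by (simp add: S_def field_simps)
  finally have Gs: "has_bochner_integral M (\<lambda>x. ?G x * s x) (S * (X / 2 - Y / 2 + 2 * X * Y))" .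

  have comp: "(\<lambda>x. x (?d i)) \<in> borel_measurable M" if "i < q" for i
  proof -
    have "?d i \<in> {1..N}" using index that by blast
    then have "(\<lambda>x. x (?d i)) \<in> measurable M lborel"
      unfolding M_def by (rule measurable_component_singleton)
    then show ?thesis by simp
  qed
  have comp': "(\<lambda>x. x (?e j)) \<in> borel_measurable M" if "j < p" for j
  proof -
    have "?e j \<in> {1..N}" using index that by blast
    then have "(\<lambda>x. x (?e j)) \<in> measurable M lborel"
      unfolding M_def by (rule measurable_component_singleton)
    then show ?thesis by simp
  qed
  let ?U = "{x. (\<forall>i<q. x (?d i) \<in> {0<..<1}) \<and> (\<forall>j<p. x (?e j) \<in> {0<..<1})}"
  have supp: "?G x = 0" if "x \<notin> ?U" for x
    using that selberg_density_eq_0 by blast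
  have F: "dominated_expansion M ?U (coupling q p) s"
  proof -
    have 1: "dominated_expansion M ?U (\<lambda>t x. \<Prod>i<q. (1 - t * x (?d i)) powr (- 1 / 2))
        (\<lambda>x. \<Sum>i<q. - (- 1 / 2) * x (?d i))"
      by (intro dominated_expansion_prod dominated_expansion_powr comp) (auto intro: less_imp_le)
    have 2: "dominated_expansion M ?U (\<lambda>t x. \<Prod>j<p. (1 - t * x (?e j)) powr (1 / 2))
        (\<lambda>x. \<Sum>j<p. - (1 / 2) * x (?e j))"
      by (intro dominated_expansion_prod dominated_expansion_powr comp') (auto intro: less_imp_le)
    have unit: "x (?d i) * x (?e j) \<in> {0..1}" if "x \<in> ?U" "i < q" "j < p"
      for x :: "nat \<Rightarrow> real" and i j
      using that mult_le_one[of "x (?d i)" "x (?e j)"] by (simp add: less_imp_le)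
    have 3: "dominated_expansion M ?U (\<lambda>t x. \<Prod>i<q. \<Prod>j<p. (1 - t * (x (?d i) * x (?e j))) powr (- 2))
        (\<lambda>x. \<Sum>i<q. \<Sum>j<p. - (- 2) * (x (?d i) * x (?e j)))"
      by (intro dominated_expansion_prod dominated_expansion_powr borel_measurable_times comp comp' unit)
        auto
    have "(\<lambda>x. (\<Sum>i<q. - (- 1 / 2) * x (?d i)) + (\<Sum>j<p. - (1 / 2) * x (?e j)) +
        (\<Sum>i<q. \<Sum>j<p. - (- 2) * (x (?d i) * x (?e j)))) = s"
      by (simp add: fun_eq_iff s_def sum_distrib_left[symmetric] sum_product sum_negf
          sum_divide_distrib mult.assoc)
    with dominated_expansion_mult[OF dominated_expansion_mult[OF 1 2] 3] show ?thesis
      by (simp add: coupling_def[abs_def])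
  qed
  obtain C where C: "\<And>t. t \<in> {0<..<1} \<Longrightarrow> (\<lambda>m. C m * t ^ m) sums (\<integral>x. ?G x * coupling q p t x \<partial>M)"
    "C 0 = (\<integral>x. ?G x \<partial>M)" "C 1 = (\<integral>x. ?G x * s x \<partial>M)"
    by (rule integral_dominated_expansion[OF F _ supp]) (use G in \<open>auto simp: has_bochner_integral_iff\<close>)
  have meas: "(\<lambda>x. ?G x * coupling q p t x) \<in> borel_measurable M" for t
  proof (rule borel_measurable_times)
    show "?G \<in> borel_measurable M" using G by (auto simp: has_bochner_integral_iff)
    show "coupling q p t \<in> borel_measurable M"
      unfolding coupling_def[abs_def]
      by (intro borel_measurable_times borel_measurable_prod powr_real_measurable
          borel_measurable_diff borel_measurable_const comp comp') auto
  qed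
  show ?thesis
    by (rule that[OF C(1) _ _ meas]) (use C G Gs in \<open>auto simp: has_bochner_integral_iff\<close>)
qed

section \<open>The integrands of the form factors\<close>

lemma AE_PiM_component_neq:
  fixes c :: real
  assumes "finite I"
  shows "AE x in Pi\<^sub>M I (\<lambda>_. lborel). \<forall>i\<in>I. x i \<noteq> c"
proof (rule AE_finite_allI[OF assms])
  fix i assume i: "i \<in> I"
  interpret product_sigma_finite "\<lambda>_ :: 'a. lborel :: real measure" ..
  let ?N = "Pi\<^sub>E I (\<lambda>j. if j = i then {c} else UNIV)"
  have "emeasure (Pi\<^sub>M I (\<lambda>_. lborel)) ?N = (\<Prod>j\<in>I. emeasure lborel (if j = i then {c} else UNIV))"
    using assms by (intro emeasure_PiM) auto
  also have "\<dots> = 0" using assms i by (intro prod_zero) auto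
  finally have "?N \<in> null_sets (Pi\<^sub>M I (\<lambda>_. lborel))"
    using assms by (auto intro!: null_setsI sets_PiM_I_finite)
  then show "AE x in Pi\<^sub>M I (\<lambda>_. lborel). x i \<noteq> c"
    by (rule AE_I') (use i in \<open>auto simp: space_PiM PiE_iff extensional_def\<close>)
qed

text \<open>
  The boundary of the cube is a null set, so the values there that come from the conventions for
  division by zero and for powers do not matter.
\<close>
lemma cube_integral_eq_integral:
  fixes f g :: "(nat \<Rightarrow> real) \<Rightarrow> real"
  assumes f: "f \<in> borel_measurable (Pi\<^sub>M {1..N} (\<lambda>_. lborel))"
    and g: "g \<in> borel_measurable (Pi\<^sub>M {1..N} (\<lambda>_. lborel))"
    and eq: "\<And>x. (\<And>i. i \<in> {1..N} \<Longrightarrow> x i \<in> {0<..<1}) \<Longrightarrow> f x = g x"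
    and zero: "\<And>x i. i \<in> {1..N} \<Longrightarrow> x i \<notin> {0<..<1} \<Longrightarrow> g x = 0"
  shows "cube_integral N f = (\<integral>x. g x \<partial>(Pi\<^sub>M {1..N} (\<lambda>_. lborel)))"
  unfolding cube_integral_def set_lebesgue_integral_def
proof (rule integral_cong_AE)
  let ?M = "Pi\<^sub>M {1..N} (\<lambda>_. lborel :: real measure)"
  have "Pi\<^sub>E {1..N} (\<lambda>_. {0..1}) \<in> sets ?M" by (rule sets_PiM_I_finite) auto
  then show "(\<lambda>x. indicator (Pi\<^sub>E {1..N} (\<lambda>_. {0..1})) x *\<^sub>R f x) \<in> borel_measurable ?M"
    using f by (intro borel_measurable_scaleR borel_measurable_indicator)
  show "AE x in ?M. indicator (Pi\<^sub>E {1..N} (\<lambda>_. {0..1})) x *\<^sub>R f x = g x"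
    using AE_PiM_component_neq[of "{1..N}" 0, OF finite_atLeastAtMost]
      AE_PiM_component_neq[of "{1..N}" 1, OF finite_atLeastAtMost] AE_space
  proof eventually_elim
    case (elim x)
    show ?case
    proof (cases "\<forall>i\<in>{1..N}. x i \<in> {0<..<1}")
      case True
      then have "x \<in> Pi\<^sub>E {1..N} (\<lambda>_. {0..1})"
        using elim(3) by (force simp: space_PiM PiE_iff)
      with eq[of x] True show ?thesis by simp
    next
      case False
      then obtain i where i: "i \<in> {1..N}" "x i \<notin> {0<..<1}" by blast
      then have "x i \<notin> {0..1}" using elim(1,2) by force
      then have "x \<notin> Pi\<^sub>E {1..N} (\<lambda>_. {0..1})" using i(1) by (auto simp: PiE_iff)
      with zero[of i x, OF i] show ?thesis by simp
    qed
  qed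
qed (fact g)

lemma prod_pairs_eq:
  fixes g :: "nat \<Rightarrow> nat \<Rightarrow> 'a :: comm_monoid_mult"
  shows "(\<Prod>(j, l)\<in>{(j, l). 1 \<le> j \<and> j < l \<and> l \<le> N}. g j l) = (\<Prod>i<N. \<Prod>l<i. g (Suc l) (Suc i))"
proof -
  have "(\<Prod>i<N. \<Prod>l<i. g (Suc l) (Suc i)) =
      (\<Prod>(i, l)\<in>Sigma {..<N} (\<lambda>i. {..<i}). g (Suc l) (Suc i))"
    by (rule prod.Sigma) auto
  also have "\<dots> = (\<Prod>(j, l)\<in>{(j, l). 1 \<le> j \<and> j < l \<and> l \<le> N}. g j l)"
    by (rule prod.reindex_bij_witness[of _ "\<lambda>(j, l). (l - 1, j - 1)" "\<lambda>(i, l). (Suc l, Suc i)"]) auto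
  finally show ?thesis by simp
qed

lemma vandermonde_sq_eq:
  "(\<Prod>(j, l)\<in>{(j, l). 1 \<le> j \<and> j < l \<and> l \<le> N}. (y j - y l)\<^sup>2) = (vandermonde N (\<lambda>i. y (Suc i)))\<^sup>2"
  unfolding prod_pairs_eq vandermonde_def
  by (simp add: prod_power_distrib power2_commute)

lemma prod_split_parity:
  fixes g :: "nat \<Rightarrow> 'a :: comm_monoid_mult"
  shows "(\<Prod>i\<in>{1..2 * p}. g i) = (\<Prod>i<p. g (2 * i + 1)) * (\<Prod>j<p. g (2 * j + 2))"
    and "(\<Prod>i\<in>{1..2 * p + 1}. g i) = (\<Prod>i<p + 1. g (2 * i + 1)) * (\<Prod>j<p. g (2 * j + 2))"
proof -
  show *: "(\<Prod>i\<in>{1..2 * p}. g i) = (\<Prod>i<p. g (2 * i + 1)) * (\<Prod>j<p. g (2 * j + 2))"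
    by (induction p) (simp_all add: mult_ac)
  show "(\<Prod>i\<in>{1..2 * p + 1}. g i) = (\<Prod>i<p + 1. g (2 * i + 1)) * (\<Prod>j<p. g (2 * j + 2))"
    using * by (simp add: mult_ac)
qed

lemma parity_index_sets:
  "(\<lambda>i. 2 * i + 1) ` {..<p} \<union> (\<lambda>j. 2 * j + 2) ` {..<p} = {1..2 * p :: nat}"
  "(\<lambda>i. 2 * i + 1) ` {..<p + 1} \<union> (\<lambda>j. 2 * j + 2) ` {..<p} = {1..2 * p + 1 :: nat}"
proof -
  have "k \<in> (\<lambda>i. 2 * i + 1) ` {..<q} \<longleftrightarrow> odd k \<and> k < 2 * q" for k q :: nat
    by (auto elim!: oddE)
  moreover have "k \<in> (\<lambda>j. 2 * j + 2) ` {..<p} \<longleftrightarrow> even k \<and> 0 < k \<and> k \<le> 2 * p" for k :: nat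
  proof
    assume k: "even k \<and> 0 < k \<and> k \<le> 2 * p"
    then have "k = 2 * (k div 2 - 1) + 2" "k div 2 - 1 < p" by auto
    then show "k \<in> (\<lambda>j. 2 * j + 2) ` {..<p}" by blast
  qed auto
  ultimately show "(\<lambda>i. 2 * i + 1) ` {..<p} \<union> (\<lambda>j. 2 * j + 2) ` {..<p} = {1..2 * p :: nat}"
    "(\<lambda>i. 2 * i + 1) ` {..<p + 1} \<union> (\<lambda>j. 2 * j + 2) ` {..<p} = {1..2 * p + 1 :: nat}"
    by (auto simp: set_eq_iff Suc_le_eq less_Suc_eq_le odd_pos elim!: oddE)
qed

lemma powr_inverse_minus_one:
  fixes u r :: real
  assumes "u \<in> {0<..<1}"
  shows "(inverse u - 1) powr r = u powr (- r) * (1 - u) powr r"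
proof -
  have "inverse u - 1 = (1 - u) / u" using assms by (simp add: field_simps)
  then show ?thesis using assms by (simp add: powr_divide powr_minus field_simps)
qed

lemma even_factor:
  fixes u v t :: real
  assumes u: "u \<in> {0<..<1}" and v: "v \<in> {0<..<1}" and t: "t \<in> {0<..<1}"
  shows "u ^ n * v ^ n *
      (((1 - t * v) * (inverse v - 1)) / ((1 - t * u) * (inverse u - 1))) powr (1 / 2) =
    beta_weight (real n + 3 / 2) (1 / 2) u * beta_weight (real n + 1 / 2) (3 / 2) v *
    ((1 - t * u) powr (- 1 / 2) * (1 - t * v) powr (1 / 2))"
proof -
  have pos: "1 - t * u > 0" "1 - t * v > 0" "inverse u - 1 > 0" "inverse v - 1 > 0"
    using u v t mult_strict_mono[of t 1 u 1] mult_strict_mono[of t 1 v 1] by (auto simp: one_less_inverse_iff)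
  have "(((1 - t * v) * (inverse v - 1)) / ((1 - t * u) * (inverse u - 1))) powr (1 / 2) =
      (1 - t * v) powr (1 / 2) * (inverse v - 1) powr (1 / 2) *
      ((1 - t * u) powr (- (1 / 2)) * (inverse u - 1) powr (- (1 / 2)))"
  proof -
    have "(((1 - t * v) * (inverse v - 1)) / ((1 - t * u) * (inverse u - 1))) powr (1 / 2) =
        ((1 - t * v) powr (1 / 2) * (inverse v - 1) powr (1 / 2)) /
        ((1 - t * u) powr (1 / 2) * (inverse u - 1) powr (1 / 2))"
      using pos by (simp only: powr_divide powr_mult less_imp_le mult_nonneg_nonneg)
    then show ?thesis unfolding powr_minus_divide by simp
  qed
  then have "u ^ n * v ^ n *
      (((1 - t * v) * (inverse v - 1)) / ((1 - t * u) * (inverse u - 1))) powr (1 / 2) =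
    (u ^ n * u powr (1 / 2)) * (1 - u) powr (- (1 / 2)) *
    ((v ^ n * v powr (- (1 / 2))) * (1 - v) powr (1 / 2)) *
    ((1 - t * u) powr (- (1 / 2)) * (1 - t * v) powr (1 / 2))"
    by (simp only: powr_inverse_minus_one[OF u] powr_inverse_minus_one[OF v] minus_minus mult_ac)
  moreover have "u ^ n * u powr (1 / 2) = u powr (real n + 3 / 2 - 1)"
    "v ^ n * v powr (- (1 / 2)) = v powr (real n + 1 / 2 - 1)"
    using u v by (simp_all add: powr_realpow[symmetric] powr_add[symmetric] add_ac)
  ultimately show ?thesis
    using u v by (simp only: beta_weight_def) simp
qed

lemma odd_factor:
  fixes u t :: real
  assumes u: "u \<in> {0<..<1}"
  shows "u ^ n * (1 / u * (1 - t * u) powr (- 1 / 2) * (inverse u - 1) powr (- 1 / 2)) =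
      beta_weight (real n + 1 / 2) (1 / 2) u * (1 - t * u) powr (- 1 / 2)"
    and "u ^ n * (u * (1 - t * u) powr (1 / 2) * (inverse u - 1) powr (1 / 2)) =
      beta_weight (real n + 3 / 2) (3 / 2) u * (1 - t * u) powr (1 / 2)"
proof -
  have pos: "0 < u" and recip: "1 / u = u powr (- 1)"
    using u by (simp_all add: powr_minus_divide)
  have "u ^ n * (1 / u * u powr (1 / 2)) = u powr (real n + (- 1 + 1 / 2))"
    unfolding recip powr_realpow[OF pos, symmetric] powr_add ..
  moreover have "u ^ n * (u * u powr (- (1 / 2))) = u powr (real n + (1 + - (1 / 2)))"
    unfolding powr_realpow[OF pos, symmetric] powr_add using pos by simp
  ultimately have "u ^ n * (1 / u * u powr (1 / 2)) = u powr (real n + 1 / 2 - 1)"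
    "u ^ n * (u * u powr (- (1 / 2))) = u powr (real n + 3 / 2 - 1)"
    by (simp_all add: add_ac)
  moreover have
    "u ^ n * (1 / u * (1 - t * u) powr (- (1 / 2)) * (inverse u - 1) powr (- (1 / 2))) =
      (u ^ n * (1 / u * u powr (1 / 2))) * (1 - u) powr (- (1 / 2)) * (1 - t * u) powr (- (1 / 2))"
    "u ^ n * (u * (1 - t * u) powr (1 / 2) * (inverse u - 1) powr (1 / 2)) =
      (u ^ n * (u * u powr (- (1 / 2)))) * (1 - u) powr (1 / 2) * (1 - t * u) powr (1 / 2)"
    by (simp_all only: powr_inverse_minus_one[OF u] minus_minus mult_ac)
  ultimately show "u ^ n * (1 / u * (1 - t * u) powr (- 1 / 2) * (inverse u - 1) powr (- 1 / 2)) =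
      beta_weight (real n + 1 / 2) (1 / 2) u * (1 - t * u) powr (- 1 / 2)"
    "u ^ n * (u * (1 - t * u) powr (1 / 2) * (inverse u - 1) powr (1 / 2)) =
      beta_weight (real n + 3 / 2) (3 / 2) u * (1 - t * u) powr (1 / 2)"
    using u by (simp_all only: beta_weight_def minus_divide_left[symmetric]) simp_all
qed

lemma pairing_factor:
  fixes t u v :: real
  assumes "t \<in> {0<..<1}" "u \<in> {0<..<1}" "v \<in> {0<..<1}"
  shows "(1 - t * u * v) powi (- 2) = (1 - t * (u * v)) powr (- 2)"
proof -
  have "t * u < 1 * 1" using assms by (intro mult_strict_mono) auto
  then have "t * u * v < 1 * 1" using assms by (intro mult_strict_mono) auto
  then have "1 - t * (u * v) > 0" by (simp add: mult.assoc)
  then show ?thesis by (simp add: power_int_minus powr_minus powr_numeral mult.assoc)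
qed

lemma prod_powi_eq:
  fixes x :: "nat \<Rightarrow> real"
  assumes t: "t \<in> {0<..<1}" and u: "\<And>i. i < q \<Longrightarrow> x (2 * i + 1) \<in> {0<..<1}"
    and v: "\<And>j. j < p \<Longrightarrow> x (2 * j + 2) \<in> {0<..<1}"
  shows "(\<Prod>i<q. \<Prod>j<p. (1 - t * x (2 * i + 1) * x (2 * j + 2)) powi (- 2)) =
    (\<Prod>i<q. \<Prod>j<p. (1 - t * (x (2 * i + 1) * x (2 * j + 2))) powr (- 2))"
  by (intro prod.cong refl pairing_factor t u v) auto

lemma prod_1_eq: "(\<Prod>j\<in>{1..p}. g j) = (\<Prod>i<p. g (Suc i))"
  using prod.atLeast1_atMost_eq[of g p] by simp

lemma cube_integral_even:
  fixes t :: real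
  assumes t: "t \<in> {0<..<1}"
    and meas: "(\<lambda>x. selberg_density p (real n + 3 / 2) (1 / 2) p (real n + 1 / 2) (3 / 2) x * coupling p p t x)
      \<in> borel_measurable (Pi\<^sub>M {1..2 * p} (\<lambda>_. lborel))"
  shows "cube_integral (2 * p) (\<lambda>x.
      (\<Prod>i\<in>{1..2 * p}. x i ^ n) *
      (\<Prod>j\<in>{1..p}.
        (((1 - t * x (2 * j)) * (inverse (x (2 * j)) - 1)) /
         ((1 - t * x (2 * j - 1)) * (inverse (x (2 * j - 1)) - 1))) powr (1 / 2)) *
      (\<Prod>j\<in>{1..p}. \<Prod>l\<in>{1..p}. (1 - t * x (2 * l - 1) * x (2 * j)) powi (-2)) *
      (\<Prod>(j, l)\<in>{(j, l). 1 \<le> j \<and> j < l \<and> l \<le> p}.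
        (x (2 * j - 1) - x (2 * l - 1))\<^sup>2 * (x (2 * j) - x (2 * l))\<^sup>2)) =
    (\<integral>x. selberg_density p (real n + 3 / 2) (1 / 2) p (real n + 1 / 2) (3 / 2) x * coupling p p t x
      \<partial>(Pi\<^sub>M {1..2 * p} (\<lambda>_. lborel)))" (is "cube_integral _ ?f = _")
proof (rule cube_integral_eq_integral)
  let ?M = "Pi\<^sub>M {1..2 * p} (\<lambda>_. lborel :: real measure)"
  have comp: "(\<lambda>x. x i) \<in> borel_measurable ?M" if "i \<in> {1..2 * p}" for i
    using measurable_component_singleton[OF that, of "\<lambda>_. lborel :: real measure"] by simp
  show "?f \<in> borel_measurable ?M"
    unfolding power_int_minus power_int_numeral case_prod_unfold
    by (intro borel_measurable_times borel_measurable_prod powr_real_measurable borel_measurable_divide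
        borel_measurable_inverse borel_measurable_diff borel_measurable_power borel_measurable_const comp)
      auto
  show "selberg_density p (real n + 3 / 2) (1 / 2) p (real n + 1 / 2) (3 / 2) x * coupling p p t x = 0"
    if "i \<in> {1..2 * p}" "x i \<notin> {0<..<1}" for x i
    unfolding selberg_density_eq_0[of i p p x, unfolded parity_index_sets(1), OF that] by simp
  fix x :: "nat \<Rightarrow> real" assume x: "\<And>i. i \<in> {1..2 * p} \<Longrightarrow> x i \<in> {0<..<1}"
  let ?u = "\<lambda>i. x (2 * i + 1)" and ?v = "\<lambda>j. x (2 * j + 2)"
  have u: "?u i \<in> {0<..<1}" and v: "?v i \<in> {0<..<1}" if "i < p" for i using x that by auto
  have "(\<Prod>i\<in>{1..2 * p}. x i ^ n) *
      (\<Prod>j\<in>{1..p}.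
        (((1 - t * x (2 * j)) * (inverse (x (2 * j)) - 1)) /
         ((1 - t * x (2 * j - 1)) * (inverse (x (2 * j - 1)) - 1))) powr (1 / 2)) =
      (\<Prod>i<p. ?u i ^ n * ?v i ^ n * (((1 - t * ?v i) * (inverse (?v i) - 1)) /
         ((1 - t * ?u i) * (inverse (?u i) - 1))) powr (1 / 2))"
    unfolding prod_split_parity(1) unfolding prod_1_eq prod.distrib by simp
  also have "\<dots> = (\<Prod>i<p. beta_weight (real n + 3 / 2) (1 / 2) (?u i) * beta_weight (real n + 1 / 2) (3 / 2) (?v i) *
      ((1 - t * ?u i) powr (- 1 / 2) * (1 - t * ?v i) powr (1 / 2)))"
    by (intro prod.cong refl even_factor u v t) auto
  finally have weights: "(\<Prod>i\<in>{1..2 * p}. x i ^ n) *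
      (\<Prod>j\<in>{1..p}.
        (((1 - t * x (2 * j)) * (inverse (x (2 * j)) - 1)) /
         ((1 - t * x (2 * j - 1)) * (inverse (x (2 * j - 1)) - 1))) powr (1 / 2)) = \<dots>" .
  have pairing: "(\<Prod>j\<in>{1..p}. \<Prod>l\<in>{1..p}. (1 - t * x (2 * l - 1) * x (2 * j)) powi (-2)) =
      (\<Prod>i<p. \<Prod>j<p. (1 - t * (?u i * ?v j)) powr (- 2))"
    unfolding prod_1_eq by (subst prod.swap) (simp add: prod_powi_eq[OF t u v, simplified])
  have "(\<Prod>(j, l)\<in>{(j, l). 1 \<le> j \<and> j < l \<and> l \<le> p}.
        (x (2 * j - 1) - x (2 * l - 1))\<^sup>2 * (x (2 * j) - x (2 * l))\<^sup>2) =
      (\<Prod>(j, l)\<in>{(j, l). 1 \<le> j \<and> j < l \<and> l \<le> p}. (x (2 * j - 1) - x (2 * l - 1))\<^sup>2) *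
      (\<Prod>(j, l)\<in>{(j, l). 1 \<le> j \<and> j < l \<and> l \<le> p}. (x (2 * j) - x (2 * l))\<^sup>2)"
    by (simp add: case_prod_unfold prod.distrib)
  also have "\<dots> = (vandermonde p ?u)\<^sup>2 * (vandermonde p ?v)\<^sup>2"
    unfolding vandermonde_sq_eq[where y = "\<lambda>j. x (2 * j - 1)"] vandermonde_sq_eq[where y = "\<lambda>j. x (2 * j)"]
    by simp
  finally show "?f x = selberg_density p (real n + 3 / 2) (1 / 2) p (real n + 1 / 2) (3 / 2) x * coupling p p t x"
    unfolding weights pairing selberg_density_def coupling_def by (simp add: prod.distrib mult_ac)
qed (fact meas)

lemma cube_integral_odd:
  fixes t :: real
  assumes t: "t \<in> {0<..<1}"
    and meas: "(\<lambda>x. selberg_density (p + 1) (real n + 1 / 2) (1 / 2) p (real n + 3 / 2) (3 / 2) x *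
      coupling (p + 1) p t x) \<in> borel_measurable (Pi\<^sub>M {1..2 * p + 1} (\<lambda>_. lborel))"
  shows "cube_integral (2 * p + 1) (\<lambda>x.
      (\<Prod>i\<in>{1..2 * p + 1}. x i ^ n) *
      (\<Prod>j\<in>{1..p + 1}.
        1 / x (2 * j - 1) * (1 - t * x (2 * j - 1)) powr (- 1 / 2) *
        (inverse (x (2 * j - 1)) - 1) powr (- 1 / 2)) *
      (\<Prod>j\<in>{1..p}.
        x (2 * j) * (1 - t * x (2 * j)) powr (1 / 2) * (inverse (x (2 * j)) - 1) powr (1 / 2)) *
      (\<Prod>j\<in>{1..p + 1}. \<Prod>l\<in>{1..p}. (1 - t * x (2 * j - 1) * x (2 * l)) powi (-2)) *
      (\<Prod>(j, l)\<in>{(j, l). 1 \<le> j \<and> j < l \<and> l \<le> p + 1}. (x (2 * j - 1) - x (2 * l - 1))\<^sup>2) *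
      (\<Prod>(j, l)\<in>{(j, l). 1 \<le> j \<and> j < l \<and> l \<le> p}. (x (2 * j) - x (2 * l))\<^sup>2)) =
    (\<integral>x. selberg_density (p + 1) (real n + 1 / 2) (1 / 2) p (real n + 3 / 2) (3 / 2) x * coupling (p + 1) p t x
      \<partial>(Pi\<^sub>M {1..2 * p + 1} (\<lambda>_. lborel)))" (is "cube_integral _ ?f = _")
proof (rule cube_integral_eq_integral)
  let ?M = "Pi\<^sub>M {1..2 * p + 1} (\<lambda>_. lborel :: real measure)"
  have comp: "(\<lambda>x. x i) \<in> borel_measurable ?M" if "i \<in> {1..2 * p + 1}" for i
    using measurable_component_singleton[OF that, of "\<lambda>_. lborel :: real measure"] by simp
  show "?f \<in> borel_measurable ?M"
    unfolding power_int_minus power_int_numeral case_prod_unfold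
    by (intro borel_measurable_times borel_measurable_prod powr_real_measurable borel_measurable_divide
        borel_measurable_inverse borel_measurable_diff borel_measurable_power borel_measurable_const comp)
      auto
  show "selberg_density (p + 1) (real n + 1 / 2) (1 / 2) p (real n + 3 / 2) (3 / 2) x * coupling (p + 1) p t x = 0"
    if "i \<in> {1..2 * p + 1}" "x i \<notin> {0<..<1}" for x i
    unfolding selberg_density_eq_0[of i "p + 1" p x, unfolded parity_index_sets(2), OF that] by simp
  fix x :: "nat \<Rightarrow> real" assume x: "\<And>i. i \<in> {1..2 * p + 1} \<Longrightarrow> x i \<in> {0<..<1}"
  let ?u = "\<lambda>i. x (2 * i + 1)" and ?v = "\<lambda>j. x (2 * j + 2)"
  have u: "?u i \<in> {0<..<1}" if "i < p + 1" for i using x that by auto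
  have v: "?v j \<in> {0<..<1}" if "j < p" for j using x that by auto
  have "(\<Prod>i\<in>{1..2 * p + 1}. x i ^ n) *
      (\<Prod>j\<in>{1..p + 1}.
        1 / x (2 * j - 1) * (1 - t * x (2 * j - 1)) powr (- 1 / 2) *
        (inverse (x (2 * j - 1)) - 1) powr (- 1 / 2)) *
      (\<Prod>j\<in>{1..p}.
        x (2 * j) * (1 - t * x (2 * j)) powr (1 / 2) * (inverse (x (2 * j)) - 1) powr (1 / 2)) =
      (\<Prod>i<p + 1. ?u i ^ n * (1 / ?u i * (1 - t * ?u i) powr (- 1 / 2) * (inverse (?u i) - 1) powr (- 1 / 2))) *
      (\<Prod>j<p. ?v j ^ n * (?v j * (1 - t * ?v j) powr (1 / 2) * (inverse (?v j) - 1) powr (1 / 2)))"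
    unfolding prod_split_parity(2) unfolding prod_1_eq prod.distrib by (simp del: prod.lessThan_Suc)
  also have "\<dots> = (\<Prod>i<p + 1. beta_weight (real n + 1 / 2) (1 / 2) (?u i) * (1 - t * ?u i) powr (- 1 / 2)) *
      (\<Prod>j<p. beta_weight (real n + 3 / 2) (3 / 2) (?v j) * (1 - t * ?v j) powr (1 / 2))"
    by (intro arg_cong2[where f = "(*)"] prod.cong refl odd_factor u v) auto
  finally have weights: "(\<Prod>i\<in>{1..2 * p + 1}. x i ^ n) *
      (\<Prod>j\<in>{1..p + 1}.
        1 / x (2 * j - 1) * (1 - t * x (2 * j - 1)) powr (- 1 / 2) *
        (inverse (x (2 * j - 1)) - 1) powr (- 1 / 2)) *
      (\<Prod>j\<in>{1..p}.
        x (2 * j) * (1 - t * x (2 * j)) powr (1 / 2) * (inverse (x (2 * j)) - 1) powr (1 / 2)) = \<dots>" .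
  have pairing: "(\<Prod>j\<in>{1..p + 1}. \<Prod>l\<in>{1..p}. (1 - t * x (2 * j - 1) * x (2 * l)) powi (-2)) =
      (\<Prod>i<p + 1. \<Prod>j<p. (1 - t * (?u i * ?v j)) powr (- 2))"
    using prod_powi_eq[where t = t and q = "p + 1" and x = x and p = p, OF t u v]
    unfolding prod_1_eq by (simp del: prod.lessThan_Suc)
  have pairs: "(\<Prod>(j, l)\<in>{(j, l). 1 \<le> j \<and> j < l \<and> l \<le> p + 1}. (x (2 * j - 1) - x (2 * l - 1))\<^sup>2) =
      (vandermonde (p + 1) ?u)\<^sup>2"
    "(\<Prod>(j, l)\<in>{(j, l). 1 \<le> j \<and> j < l \<and> l \<le> p}. (x (2 * j) - x (2 * l))\<^sup>2) = (vandermonde p ?v)\<^sup>2"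
    unfolding vandermonde_sq_eq[where y = "\<lambda>j. x (2 * j - 1)"] vandermonde_sq_eq[where y = "\<lambda>j. x (2 * j)"]
    by simp_all
  show "?f x = selberg_density (p + 1) (real n + 1 / 2) (1 / 2) p (real n + 3 / 2) (3 / 2) x *
      coupling (p + 1) p t x"
    unfolding weights pairing pairs selberg_density_def coupling_def
    by (simp add: prod.distrib mult_ac del: prod.lessThan_Suc)
qed (fact meas)

section \<open>The leading coefficients\<close>

lemma prod_Gamma_shift:
  fixes z :: real
  shows "Gamma z * (\<Prod>j<p. Gamma (z + 1 + real j)) = (\<Prod>j<p. Gamma (z + real j)) * Gamma (z + real p)"
  by (induction p) (simp_all add: mult_ac add_ac)

lemma selberg_even:
  "selberg p (real n + 3 / 2) (1 / 2) * selberg p (real n + 1 / 2) (3 / 2) =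
    Gamma (real n + real p + 1 / 2) * Gamma (real p + 1 / 2) / (Gamma (real n + 1 / 2) * Gamma (1 / 2)) *
    (\<Prod>j\<in>{0..<p}. Gamma (real n + real j + 1 / 2) * Gamma (real j + 1 / 2) *
       Gamma (real j + 2) / Gamma (real n + real p + real j + 1))\<^sup>2"
proof -
  define A where "A z = (\<Prod>j<p. Gamma (z + real j))" for z :: real
  define K where "K = (\<Prod>j<p. Gamma (real j + 2))"
  define D where "D = A (real n + real p + 1)"
  have S: "selberg p a b = A a * A b * K / D" if "a + b = real n + 2" for a b
    using that by (simp add: selberg_def A_def K_def D_def prod_dividef prod.distrib algebra_simps)
  have nz: "Gamma (real n + 1 / 2) \<noteq> 0" "Gamma (1 / 2 :: real) \<noteq> 0"
    using Gamma_real_pos[of "real n + 1 / 2"] Gamma_real_pos[of "1 / 2"] by linarith+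
  have shift: "A (real n + 3 / 2) = A (real n + 1 / 2) * Gamma (real n + real p + 1 / 2) / Gamma (real n + 1 / 2)"
    "A (3 / 2) = A (1 / 2) * Gamma (real p + 1 / 2) / Gamma (1 / 2)"
    using prod_Gamma_shift[of "real n + 1 / 2" p] prod_Gamma_shift[of "1 / 2" p] nz
    by (simp_all add: A_def field_simps)
  have T: "(\<Prod>j\<in>{0..<p}. Gamma (real n + real j + 1 / 2) * Gamma (real j + 1 / 2) *
       Gamma (real j + 2) / Gamma (real n + real p + real j + 1)) = A (real n + 1 / 2) * A (1 / 2) * K / D"
    by (simp add: A_def K_def D_def prod_dividef prod.distrib lessThan_atLeast0 algebra_simps)
  show ?thesis
    unfolding T by (simp add: S shift power2_eq_square mult_ac)
qed

lemma selberg_odd: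
  "selberg (p + 1) (real n + 1 / 2) (1 / 2) * selberg p (real n + 3 / 2) (3 / 2) =
    fact (p + 1) * (Gamma (real n + 1 / 2) * Gamma (1 / 2) / Gamma (real n + real p + 1)) *
    (\<Prod>j\<in>{0..<p}. Gamma (real n + real j + 3 / 2) * Gamma (real j + 3 / 2) *
       Gamma (real j + 2) / Gamma (real n + real p + real j + 2))\<^sup>2"
proof -
  define A where "A z = (\<Prod>j<p. Gamma (z + real j))" for z :: real
  define K where "K = (\<Prod>j<p. Gamma (real j + 2))"
  define D where "D = A (real n + real p + 2)"
  have Suc_prod: "(\<Prod>j<p + 1. Gamma (z + real j)) = Gamma z * A (z + 1)" for z :: real
    using prod.lessThan_Suc_shift[of "\<lambda>j. Gamma (z + real j)" p] by (simp add: A_def add_ac)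
  have K': "(\<Prod>j<p + 1. Gamma (real j + 2)) = K * fact (p + 1)"
    using Gamma_fact[of "Suc p", where 'a = real] by (simp add: K_def add_ac)
  have "selberg (p + 1) (real n + 1 / 2) (1 / 2) =
      (\<Prod>j<p + 1. Gamma (real n + 1 / 2 + real j)) * (\<Prod>j<p + 1. Gamma (1 / 2 + real j)) *
      (\<Prod>j<p + 1. Gamma (real j + 2)) / (\<Prod>j<p + 1. Gamma (real n + real p + 1 + real j))"
    unfolding selberg_def prod_dividef prod.distrib by (simp add: add_ac)
  also have "\<dots> = (Gamma (real n + 1 / 2) * A (real n + 3 / 2)) * (Gamma (1 / 2) * A (3 / 2)) *
      (K * fact (p + 1)) / (Gamma (real n + real p + 1) * D)"
    unfolding Suc_prod K' by (simp add: D_def add_ac)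
  finally have 1: "selberg (p + 1) (real n + 1 / 2) (1 / 2) = \<dots>" .
  have 2: "selberg p (real n + 3 / 2) (3 / 2) = A (real n + 3 / 2) * A (3 / 2) * K / D"
    by (simp add: selberg_def A_def K_def D_def prod_dividef prod.distrib algebra_simps)
  have T: "(\<Prod>j\<in>{0..<p}. Gamma (real n + real j + 3 / 2) * Gamma (real j + 3 / 2) *
       Gamma (real j + 2) / Gamma (real n + real p + real j + 2)) = A (real n + 3 / 2) * A (3 / 2) * K / D"
    by (simp add: A_def K_def D_def prod_dividef prod.distrib lessThan_atLeast0 algebra_simps)
  show ?thesis unfolding T 1 2 by (simp add: power2_eq_square mult_ac)
qed

text \<open>As \<open>k\<close> varies, the parameter \<open>t\<close> takes exactly the values between \<open>0\<close> and \<open>1\<close>.\<close>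
lemma all_modulus_low_iff:
  "(\<forall>k t :: real. k > 1 \<and> t = k powi (- 2) \<longrightarrow> Q t) \<longleftrightarrow> (\<forall>t\<in>{0<..<1}. Q t)"
proof (intro iffI ballI allI impI)
  fix t :: real assume Q: "\<forall>k t. k > 1 \<and> t = k powi (- 2) \<longrightarrow> Q t" and t: "t \<in> {0<..<1}"
  have "1 / sqrt t > 1" "t = (1 / sqrt t) powi (- 2)"
    using t by (simp_all add: power_int_minus power_divide)
  with Q show "Q t" by blast
next
  fix k t :: real assume Q: "\<forall>t\<in>{0<..<1}. Q t" and k: "k > 1 \<and> t = k powi (- 2)"
  then have "t = inverse (k\<^sup>2)" "k\<^sup>2 > 1" "k \<noteq> 0"
    by (auto simp: power_int_minus one_less_power)
  then have "t \<in> {0<..<1}" by (simp add: inverse_less_1_iff)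
  with Q show "Q t" by blast
qed

lemma all_modulus_high_iff:
  "(\<forall>k t :: real. 0 < k \<and> k < 1 \<and> t = k\<^sup>2 \<longrightarrow> Q t) \<longleftrightarrow> (\<forall>t\<in>{0<..<1}. Q t)"
proof (intro iffI ballI allI impI)
  fix t :: real assume Q: "\<forall>k t. 0 < k \<and> k < 1 \<and> t = k\<^sup>2 \<longrightarrow> Q t" and t: "t \<in> {0<..<1}"
  then have "0 < sqrt t" "sqrt t < 1" "t = (sqrt t)\<^sup>2" by simp_all
  with Q show "Q t" by blast
next
  fix k t :: real assume Q: "\<forall>t\<in>{0<..<1}. Q t" and k: "0 < k \<and> k < 1 \<and> t = k\<^sup>2"
  then have "t \<in> {0<..<1}" by (simp add: power_less_one_iff)
  with Q show "Q t" by blast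
qed

lemma low_temp_expansion_iff:
  "low_temp_expansion n p c \<longleftrightarrow>
    (\<forall>t\<in>{0<..<1}. (\<lambda>m. c m * t ^ m) sums (form_factor_even n p t / t ^ (p * (n + p))))"
  unfolding low_temp_expansion_def all_modulus_low_iff
  by (intro ball_cong refl) (auto simp: sums_iff field_simps)

lemma high_temp_expansion_iff:
  "high_temp_expansion n p c \<longleftrightarrow>
    (\<forall>t\<in>{0<..<1}. (\<lambda>m. c m * t ^ m) sums
      (form_factor_odd n p t / t powr (real n * (real p + 1 / 2) + real p * (real p + 1))))"
  unfolding high_temp_expansion_def all_modulus_high_iff
  by (intro ball_cong refl) (auto simp: sums_iff field_simps)

lemma low_temp_coefficients:
  obtains c where "low_temp_expansion n p c"
    and "c 0 = 1 / ((fact p)\<^sup>2 * pi ^ (2 * p)) *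
      (selberg p (real n + 3 / 2) (1 / 2) * selberg p (real n + 1 / 2) (3 / 2))"
    and "c 1 = c 0 * (real p * (real n + real p) / (2 * (real n + 2 * real p)\<^sup>2)) *
      (4 * real p * (real n + real p) + 1)"
proof -
  let ?S = "selberg p (real n + 3 / 2) (1 / 2) * selberg p (real n + 1 / 2) (3 / 2)"
  let ?X = "real p * (real n + 3 / 2 + real p - 1) / (real n + 3 / 2 + 1 / 2 + 2 * real p - 2)"
  let ?Y = "real p * (real n + 1 / 2 + real p - 1) / (real n + 1 / 2 + 3 / 2 + 2 * real p - 2)"
  let ?K = "1 / ((fact p)\<^sup>2 * pi ^ (2 * p))"
  obtain C where C: "\<And>t. t \<in> {0<..<1} \<Longrightarrow>
       (\<lambda>m. C m * t ^ m) sums (\<integral>x. selberg_density p (real n + 3 / 2) (1 / 2) p (real n + 1 / 2) (3 / 2) x *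
         coupling p p t x \<partial>(Pi\<^sub>M {1..2 * p} (\<lambda>_. lborel)))"
    and C0: "C 0 = ?S" and C1: "C 1 = ?S * (?X / 2 - ?Y / 2 + 2 * ?X * ?Y)"
    and meas: "\<And>t. (\<lambda>x. selberg_density p (real n + 3 / 2) (1 / 2) p (real n + 1 / 2) (3 / 2) x *
         coupling p p t x) \<in> borel_measurable (Pi\<^sub>M {1..2 * p} (\<lambda>_. lborel))"
    by (rule form_factor_series[of "real n + 3 / 2" "1 / 2" "real n + 1 / 2" "3 / 2" p p "2 * p",
          OF _ _ _ _ parity_index_sets(1)]) auto
  have "(\<lambda>m. ?K * C m * t ^ m) sums (form_factor_even n p t / t ^ (p * (n + p)))"
    if t: "t \<in> {0<..<1}" for t
    using sums_mult[OF C[OF t], of ?K] t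
    unfolding form_factor_even_def cube_integral_even[OF t meas] by (simp add: mult.assoc)
  then have exp: "low_temp_expansion n p (\<lambda>m. ?K * C m)"
    by (simp add: low_temp_expansion_iff)
  have "?X / 2 - ?Y / 2 + 2 * ?X * ?Y =
      (real p * (real n + real p) / (2 * (real n + 2 * real p)\<^sup>2)) * (4 * real p * (real n + real p) + 1)"
    \<comment> \<open>For \<open>p = 0\<close> both sides are \<open>0\<close>, even when the denominator \<open>n + 2 * p\<close> is \<open>0\<close>.\<close>
  proof (cases "p = 0")
    case False
    define D where "D = real n + 2 * real p"
    have D: "D \<noteq> 0" using False by (simp add: D_def)
    have X: "?X = real p * (real n + real p + 1 / 2) / D" and Y: "?Y = real p * (real n + real p - 1 / 2) / D"
      by (simp_all add: D_def algebra_simps)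
    have "?X / 2 - ?Y / 2 = real p * D / (2 * D\<^sup>2)"
      unfolding X Y using D by (simp add: field_simps power2_eq_square)
    moreover have "2 * ?X * ?Y = real p * (4 * real p * ((real n + real p + 1 / 2) * (real n + real p - 1 / 2))) / (2 * D\<^sup>2)"
      unfolding X Y using D by (simp add: field_simps power2_eq_square)
    moreover have "real p * D + real p * (4 * real p * ((real n + real p + 1 / 2) * (real n + real p - 1 / 2))) =
        real p * (real n + real p) * (4 * real p * (real n + real p) + 1)"
      by (simp add: D_def field_simps)
    ultimately have "?X / 2 - ?Y / 2 + 2 * ?X * ?Y =
        real p * (real n + real p) * (4 * real p * (real n + real p) + 1) / (2 * D\<^sup>2)"
      by (simp only: add_divide_distrib[symmetric])
    then show ?thesis by (simp add: D_def)
  qed simp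
  with C1 have "?K * C 1 = ?K * C 0 * (real p * (real n + real p) / (2 * (real n + 2 * real p)\<^sup>2)) *
      (4 * real p * (real n + real p) + 1)"
    by (simp only: C0 mult.assoc)
  with that[OF exp] C0 show ?thesis by simp
qed

lemma high_temp_coefficients:
  obtains c where "high_temp_expansion n p c"
    and "c 0 = 1 / (fact p * fact (p + 1) * pi ^ (2 * p + 1)) *
      (selberg (p + 1) (real n + 1 / 2) (1 / 2) * selberg p (real n + 3 / 2) (3 / 2))"
    and "c 1 = c 0 * ((real n + real p + 1 / 2) / (2 * (real n + 2 * real p + 1)\<^sup>2)) *
      (4 * real p * (real p + 1) * (real n + real p + 1 / 2) + real n + 2 * real p + 1)"
proof -
  let ?S = "selberg (p + 1) (real n + 1 / 2) (1 / 2) * selberg p (real n + 3 / 2) (3 / 2)"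
  let ?X = "real (p + 1) * (real n + 1 / 2 + real (p + 1) - 1) / (real n + 1 / 2 + 1 / 2 + 2 * real (p + 1) - 2)"
  let ?Y = "real p * (real n + 3 / 2 + real p - 1) / (real n + 3 / 2 + 3 / 2 + 2 * real p - 2)"
  let ?K = "1 / (fact p * fact (p + 1) * pi ^ (2 * p + 1))"
  obtain C where C: "\<And>t. t \<in> {0<..<1} \<Longrightarrow>
       (\<lambda>m. C m * t ^ m) sums (\<integral>x. selberg_density (p + 1) (real n + 1 / 2) (1 / 2) p (real n + 3 / 2) (3 / 2) x *
         coupling (p + 1) p t x \<partial>(Pi\<^sub>M {1..2 * p + 1} (\<lambda>_. lborel)))"
    and C0: "C 0 = ?S" and C1: "C 1 = ?S * (?X / 2 - ?Y / 2 + 2 * ?X * ?Y)"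
    and meas: "\<And>t. (\<lambda>x. selberg_density (p + 1) (real n + 1 / 2) (1 / 2) p (real n + 3 / 2) (3 / 2) x *
         coupling (p + 1) p t x) \<in> borel_measurable (Pi\<^sub>M {1..2 * p + 1} (\<lambda>_. lborel))"
    by (rule form_factor_series[of "real n + 1 / 2" "1 / 2" "real n + 3 / 2" "3 / 2" "p + 1" p "2 * p + 1",
          OF _ _ _ _ parity_index_sets(2)]) auto
  have "(\<lambda>m. ?K * C m * t ^ m) sums
      (form_factor_odd n p t / t powr (real n * (real p + 1 / 2) + real p * (real p + 1)))"
    if t: "t \<in> {0<..<1}" for t
    using sums_mult[OF C[OF t], of ?K] t
    unfolding form_factor_odd_def cube_integral_odd[OF t meas] by (simp add: mult.assoc)
  then have exp: "high_temp_expansion n p (\<lambda>m. ?K * C m)"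
    by (simp add: high_temp_expansion_iff)
  have "?X / 2 - ?Y / 2 + 2 * ?X * ?Y =
      ((real n + real p + 1 / 2) / (2 * (real n + 2 * real p + 1)\<^sup>2)) *
      (4 * real p * (real p + 1) * (real n + real p + 1 / 2) + real n + 2 * real p + 1)"
  proof -
    define D where "D = real n + 2 * real p + 1"
    define B where "B = real n + real p + 1 / 2"
    have D: "D \<noteq> 0" by (simp add: D_def)
    have X: "?X = (real p + 1) * B / D" and Y: "?Y = real p * B / D"
      by (simp_all add: D_def B_def algebra_simps)
    have "?X / 2 - ?Y / 2 + 2 * ?X * ?Y = B / (2 * D\<^sup>2) * (4 * real p * (real p + 1) * B + D)"
      unfolding X Y using D by (simp add: field_simps power2_eq_square)
    then show ?thesis by (simp add: D_def B_def add.assoc)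
  qed
  with C1 have "?K * C 1 = ?K * C 0 * ((real n + real p + 1 / 2) / (2 * (real n + 2 * real p + 1)\<^sup>2)) *
      (4 * real p * (real p + 1) * (real n + real p + 1 / 2) + real n + 2 * real p + 1)"
    by (simp only: C0 mult.assoc)
  with that[OF exp] C0 show ?thesis by simp
qed

theorem proposition2p1:
  fixes n :: nat
  shows
    "(\<forall>p\<ge>1. (\<exists>c. low_temp_expansion n p c) \<and>
       (\<forall>c. low_temp_expansion n p c \<longrightarrow>
         c 0 = 1 / ((fact p)\<^sup>2 * pi ^ (2 * p)) *
           (Gamma (real n + real p + 1 / 2) * Gamma (real p + 1 / 2) /
             (Gamma (real n + 1 / 2) * Gamma (1 / 2))) *
           (\<Prod>j\<in>{0..<p}. Gamma (real n + real j + 1 / 2) * Gamma (real j + 1 / 2) *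
              Gamma (real j + 2) / Gamma (real n + real p + real j + 1))\<^sup>2 \<and>
         c 1 = c 0 * (real p * (real n + real p) / (2 * (real n + 2 * real p)\<^sup>2)) *
           (4 * real p * (real n + real p) + 1))) \<and>
     (\<forall>p. (\<exists>c. high_temp_expansion n p c) \<and>
       (\<forall>c. high_temp_expansion n p c \<longrightarrow>
         c 0 = 1 / (fact p * pi ^ (2 * p + 1)) *
           (Gamma (real n + 1 / 2) * Gamma (1 / 2) / Gamma (real n + real p + 1)) *
           (\<Prod>j\<in>{0..<p}. Gamma (real n + real j + 3 / 2) * Gamma (real j + 3 / 2) *
              Gamma (real j + 2) / Gamma (real n + real p + real j + 2))\<^sup>2 \<and>
         c 1 = c 0 * ((real n + real p + 1 / 2) / (2 * (real n + 2 * real p + 1)\<^sup>2)) *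
           (4 * real p * (real p + 1) * (real n + real p + 1 / 2) + real n + 2 * real p + 1)))"
    (is "(\<forall>p\<ge>1. ?E p \<and> ?L p) \<and> (\<forall>p. ?E' p \<and> ?H p)")
proof (intro conjI allI impI)
  fix p
  obtain c where c: "low_temp_expansion n p c"
    "c 0 = 1 / ((fact p)\<^sup>2 * pi ^ (2 * p)) *
      (selberg p (real n + 3 / 2) (1 / 2) * selberg p (real n + 1 / 2) (3 / 2))"
    "c 1 = c 0 * (real p * (real n + real p) / (2 * (real n + 2 * real p)\<^sup>2)) *
      (4 * real p * (real n + real p) + 1)"
    by (rule low_temp_coefficients)
  show "?E p" using c(1) by blast
  fix d assume "low_temp_expansion n p d"
  then have "d = c"
    using c(1) unfolding low_temp_expansion_iff by (intro powser_coeffs_unique) auto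
  then show "d 0 = 1 / ((fact p)\<^sup>2 * pi ^ (2 * p)) *
           (Gamma (real n + real p + 1 / 2) * Gamma (real p + 1 / 2) /
             (Gamma (real n + 1 / 2) * Gamma (1 / 2))) *
           (\<Prod>j\<in>{0..<p}. Gamma (real n + real j + 1 / 2) * Gamma (real j + 1 / 2) *
              Gamma (real j + 2) / Gamma (real n + real p + real j + 1))\<^sup>2"
    and "d 1 = d 0 * (real p * (real n + real p) / (2 * (real n + 2 * real p)\<^sup>2)) *
           (4 * real p * (real n + real p) + 1)"
    using c(2,3) unfolding selberg_even by (simp_all only: mult.assoc)
next
  fix p
  obtain c where c: "high_temp_expansion n p c"
    "c 0 = 1 / (fact p * fact (p + 1) * pi ^ (2 * p + 1)) *
      (selberg (p + 1) (real n + 1 / 2) (1 / 2) * selberg p (real n + 3 / 2) (3 / 2))"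
    "c 1 = c 0 * ((real n + real p + 1 / 2) / (2 * (real n + 2 * real p + 1)\<^sup>2)) *
      (4 * real p * (real p + 1) * (real n + real p + 1 / 2) + real n + 2 * real p + 1)"
    by (rule high_temp_coefficients)
  show "?E' p" using c(1) by blast
  fix d assume "high_temp_expansion n p d"
  then have d: "d = c"
    using c(1) unfolding high_temp_expansion_iff by (intro powser_coeffs_unique) auto
  have "1 / (fact p * fact (p + 1) * pi ^ (2 * p + 1)) * (fact (p + 1) * z) =
      1 / (fact p * pi ^ (2 * p + 1)) * z" for z :: real
    by (simp del: fact_Suc)
  then show "d 0 = 1 / (fact p * pi ^ (2 * p + 1)) *
           (Gamma (real n + 1 / 2) * Gamma (1 / 2) / Gamma (real n + real p + 1)) *
           (\<Prod>j\<in>{0..<p}. Gamma (real n + real j + 3 / 2) * Gamma (real j + 3 / 2) *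
              Gamma (real j + 2) / Gamma (real n + real p + real j + 2))\<^sup>2"
    unfolding d c(2) selberg_odd by (simp only: mult.assoc)
  show "d 1 = d 0 * ((real n + real p + 1 / 2) / (2 * (real n + 2 * real p + 1)\<^sup>2)) *
           (4 * real p * (real p + 1) * (real n + real p + 1 / 2) + real n + 2 * real p + 1)"
    using c(3) unfolding d .
qed

end
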